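(* Let $X$, $Y$ be Banach spaces. Then the following hold: (a) $n(X\hat{\otimes}_\pi Y)\leq \min\{n(X),n(Y)\}$, (b) $n(X\hat{\otimes}_\varepsilon Y)\leq \min\{n(X),n(Y)\}$.
   Context: Banach spaces are (nonzero) real or complex; $X$ and $Y$ are over the same field. $S_X$, $B_X$ denote the unit sphere and closed unit ball of $X$, $X^*$ its topological dual, and $\mathcal{L}(X)$ the Banach space of bounded linear operators on $X$ with the operator norm. For $T\in\mathcal{L}(X)$ the numerical radius is $v(T)=\sup\{|x^*(Tx)| : x\in S_X,\ x^*\in S_{X^*},\ x^*(x)=1\}$. The numerical index of $X$ is $n(X)=\inf\{v(T): T\in\mathcal{L}(X),\ \|T\|=1\}$. The projective tensor product $X\hat{\otimes}_\pi Y$ is the completion of $X\otimes Y$ under $\|u\|_\pi=\inf\{\sum_{i=1}^n\|x_i\|\,\|y_i\| : u=\sum_{i=1}^n x_i\otimes y_i\}$. The injective tensor product $X\hat{\otimes}_\varepsilon Y$ is the completion of $X\otimes Y$ under $\|u\|_\varepsilon=\sup\{|\sum_{i=1}^n x^*(x_i)y^*(y_i)| : x^*\in B_{X^*},\ y^*\in B_{Y^*}\}$, where $\sum_{i=1}^n x_i\otimes y_i$ is any representation of $u$. *)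

theory Defs
  imports Complex_Main "HOL-Algebra.Module"
begin

section \<open>Scalars\<close>

text \<open>
  The normed fields that are isometrically isomorphic to the reals or to the complex numbers.
  This allows real and complex Banach spaces to be treated simultaneously.
\<close>

class real_or_complex = real_normed_field +
  assumes real_or_complex:
    "(\<forall>z. \<exists>a. z = a *\<^sub>R 1) \<or>
     (\<exists>i. i * i = - 1 \<and>
        (\<forall>z. \<exists>a b. z = a *\<^sub>R 1 + b *\<^sub>R i \<and> norm z = sqrt (a\<^sup>2 + b\<^sup>2)))"

instance real :: real_or_complex
  by standard auto

instance complex :: real_or_complex
proof
  have "\<exists>i::complex. i * i = - 1 \<and>
      (\<forall>z. \<exists>a b. z = a *\<^sub>R 1 + b *\<^sub>R i \<and> norm z = sqrt (a\<^sup>2 + b\<^sup>2))"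
  proof (intro exI[of _ \<i>] conjI allI)
    fix z :: complex
    show "\<exists>a b. z = a *\<^sub>R 1 + b *\<^sub>R \<i> \<and> norm z = sqrt (a\<^sup>2 + b\<^sup>2)"
      by (intro exI[of _ "Re z"] exI[of _ "Im z"]) (simp add: complex_eq_iff cmod_def)
  qed simp
  then show "(\<forall>z::complex. \<exists>a. z = a *\<^sub>R 1) \<or>
     (\<exists>i::complex. i * i = - 1 \<and>
        (\<forall>z. \<exists>a b. z = a *\<^sub>R 1 + b *\<^sub>R i \<and> norm z = sqrt (a\<^sup>2 + b\<^sup>2)))" ..
qed


section \<open>Normed spaces and Banach spaces\<close>

text \<open>
  Vector spaces are modules in the sense of HOL-Algebra, so that they have explicit carriers:
  the tensor products below depend on the spaces \<open>X\<close> and \<open>Y\<close> as terms. The ring fields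
  \<open>mult\<close> and \<open>one\<close> of a module record play no role.
\<close>

record ('k, 'v) normed = "('k, 'v) module" +
  nrm :: "'v \<Rightarrow> real"

definition scalar_space :: "('k::real_or_complex, 'k) normed" where
  "scalar_space =
     \<lparr>carrier = UNIV, mult = (*), one = 1, zero = 0, add = (+), smult = (*), nrm = norm\<rparr>"

locale normed_space =
  fixes X :: "('k::real_or_complex, 'v) normed" (structure)
  assumes module: "module scalar_space X"
    and nrm_eq_zero_iff: "x \<in> carrier X \<Longrightarrow> nrm X x = 0 \<longleftrightarrow> x = \<zero>"
    and nrm_add_le: "x \<in> carrier X \<Longrightarrow> y \<in> carrier X \<Longrightarrow> nrm X (x \<oplus> y) \<le> nrm X x + nrm X y"
    and nrm_smult: "x \<in> carrier X \<Longrightarrow> nrm X (c \<odot> x) = norm c * nrm X x"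

definition cauchy_seq :: "('k, 'v) normed \<Rightarrow> (nat \<Rightarrow> 'v) \<Rightarrow> bool" where
  "cauchy_seq X s \<longleftrightarrow> range s \<subseteq> carrier X \<and>
     (\<forall>e>0. \<exists>N. \<forall>m\<ge>N. \<forall>n\<ge>N. nrm X (s m \<ominus>\<^bsub>X\<^esub> s n) < e)"

locale banach_space = normed_space +
  assumes complete:
    "cauchy_seq X s \<Longrightarrow> \<exists>x\<in>carrier X. (\<lambda>n. nrm X (s n \<ominus> x)) \<longlonglongrightarrow> 0"


section \<open>Operators and the numerical index\<close>

text \<open>
  Operators are functions whose values outside the carrier are arbitrary; all notions below
  only look at the values on the carrier.
\<close>

definition linear_maps :: "('k, 'v) normed \<Rightarrow> ('k, 'w) normed \<Rightarrow> ('v \<Rightarrow> 'w) set" where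
  "linear_maps X Y = {T \<in> carrier X \<rightarrow> carrier Y.
     (\<forall>x\<in>carrier X. \<forall>y\<in>carrier X. T (x \<oplus>\<^bsub>X\<^esub> y) = T x \<oplus>\<^bsub>Y\<^esub> T y) \<and>
     (\<forall>c. \<forall>x\<in>carrier X. T (c \<odot>\<^bsub>X\<^esub> x) = c \<odot>\<^bsub>Y\<^esub> T x)}"

definition bounded_ops :: "('k, 'v) normed \<Rightarrow> ('k, 'w) normed \<Rightarrow> ('v \<Rightarrow> 'w) set" where
  "bounded_ops X Y = {T \<in> linear_maps X Y. \<exists>C. \<forall>x\<in>carrier X. nrm Y (T x) \<le> C * nrm X x}"

definition op_norm :: "('k, 'v) normed \<Rightarrow> ('k, 'w) normed \<Rightarrow> ('v \<Rightarrow> 'w) \<Rightarrow> real" where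
  "op_norm X Y T = Sup {nrm Y (T x) | x. x \<in> carrier X \<and> nrm X x \<le> 1}"

definition dual :: "('k::real_or_complex, 'v) normed \<Rightarrow> ('v \<Rightarrow> 'k) set" where
  "dual X = bounded_ops X scalar_space"

definition dual_norm :: "('k::real_or_complex, 'v) normed \<Rightarrow> ('v \<Rightarrow> 'k) \<Rightarrow> real" where
  "dual_norm X = op_norm X scalar_space"

definition numerical_radius :: "('k::real_or_complex, 'v) normed \<Rightarrow> ('v \<Rightarrow> 'v) \<Rightarrow> real" where
  "numerical_radius X T = Sup {norm (f (T x)) | x f.
     x \<in> carrier X \<and> nrm X x = 1 \<and> f \<in> dual X \<and> dual_norm X f = 1 \<and> f x = 1}"

definition numerical_index :: "('k::real_or_complex, 'v) normed \<Rightarrow> real" where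
  "numerical_index X = Inf {numerical_radius X T | T. T \<in> bounded_ops X X \<and> op_norm X X T = 1}"


section \<open>Completion\<close>

text \<open>Cauchy sequences modulo null sequences.\<close>

definition null_rel :: "('k, 'v) normed \<Rightarrow> ((nat \<Rightarrow> 'v) \<times> (nat \<Rightarrow> 'v)) set" where
  "null_rel V = {(s, t). cauchy_seq V s \<and> cauchy_seq V t \<and>
     (\<lambda>n. nrm V (s n \<ominus>\<^bsub>V\<^esub> t n)) \<longlonglongrightarrow> 0}"

definition completion :: "('k, 'v) normed \<Rightarrow> ('k, (nat \<Rightarrow> 'v) set) normed" where
  "completion V =
     \<lparr>carrier = Collect (cauchy_seq V) // null_rel V,
      mult = undefined,
      one = undefined,
      zero = null_rel V `` {\<lambda>n. \<zero>\<^bsub>V\<^esub>},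
      add = (\<lambda>P Q. \<Union>s\<in>P. \<Union>t\<in>Q. null_rel V `` {\<lambda>n. s n \<oplus>\<^bsub>V\<^esub> t n}),
      smult = (\<lambda>c P. \<Union>s\<in>P. null_rel V `` {\<lambda>n. c \<odot>\<^bsub>V\<^esub> s n}),
      nrm = (\<lambda>P. THE r. \<forall>s\<in>P. (\<lambda>n. nrm V (s n)) \<longlonglongrightarrow> r)\<rparr>"


section \<open>Tensor products\<close>

definition bilinear_forms :: "('k::real_or_complex, 'a) normed \<Rightarrow> ('k, 'b) normed \<Rightarrow> ('a \<Rightarrow> 'b \<Rightarrow> 'k) set" where
  "bilinear_forms X Y = {B.
     (\<forall>x\<in>carrier X. B x \<in> linear_maps Y scalar_space) \<and>
     (\<forall>y\<in>carrier Y. (\<lambda>x. B x y) \<in> linear_maps X scalar_space)}"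

text \<open>
  The list \<open>[(x\<^sub>1, y\<^sub>1), \<dots>, (x\<^sub>n, y\<^sub>n)]\<close> represents the tensor
  \<open>x\<^sub>1 \<otimes> y\<^sub>1 + \<dots> + x\<^sub>n \<otimes> y\<^sub>n\<close>. As usual, the elementary tensor \<open>x \<otimes> y\<close>
  is realised as the evaluation \<open>B \<mapsto> B x y\<close> on the (not necessarily bounded) bilinear forms,
  so that \<open>X \<otimes> Y\<close> is a space of functionals on bilinear forms, with pointwise operations.
\<close>

definition tensor_sum ::
    "('k::real_or_complex, 'a) normed \<Rightarrow> ('k, 'b) normed \<Rightarrow> ('a \<times> 'b) list \<Rightarrow> ('a \<Rightarrow> 'b \<Rightarrow> 'k) \<Rightarrow> 'k" where
  "tensor_sum X Y ps =
     (\<lambda>B. if B \<in> bilinear_forms X Y then \<Sum>(x, y)\<leftarrow>ps. B x y else 0)"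

definition representations ::
    "('k::real_or_complex, 'a) normed \<Rightarrow> ('k, 'b) normed \<Rightarrow> (('a \<Rightarrow> 'b \<Rightarrow> 'k) \<Rightarrow> 'k) \<Rightarrow> ('a \<times> 'b) list set" where
  "representations X Y u =
     {ps. set ps \<subseteq> carrier X \<times> carrier Y \<and> u = tensor_sum X Y ps}"

text \<open>The algebraic tensor product, equipped with a given norm.\<close>

definition tensor_space ::
    "('k::real_or_complex, 'a) normed \<Rightarrow> ('k, 'b) normed \<Rightarrow> ((('a \<Rightarrow> 'b \<Rightarrow> 'k) \<Rightarrow> 'k) \<Rightarrow> real)
      \<Rightarrow> ('k, ('a \<Rightarrow> 'b \<Rightarrow> 'k) \<Rightarrow> 'k) normed" where
  "tensor_space X Y N =
     \<lparr>carrier = {u. representations X Y u \<noteq> {}},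
      mult = undefined,
      one = undefined,
      zero = (\<lambda>B. 0),
      add = (\<lambda>u v B. u B + v B),
      smult = (\<lambda>c u B. c * u B),
      nrm = N\<rparr>"

definition proj_norm ::
    "('k::real_or_complex, 'a) normed \<Rightarrow> ('k, 'b) normed \<Rightarrow> (('a \<Rightarrow> 'b \<Rightarrow> 'k) \<Rightarrow> 'k) \<Rightarrow> real" where
  "proj_norm X Y u = Inf {\<Sum>(x, y)\<leftarrow>ps. nrm X x * nrm Y y | ps. ps \<in> representations X Y u}"

text \<open>The sum below does not depend on the choice of the representation \<open>ps\<close> of \<open>u\<close>.\<close>

definition inj_norm ::
    "('k::real_or_complex, 'a) normed \<Rightarrow> ('k, 'b) normed \<Rightarrow> (('a \<Rightarrow> 'b \<Rightarrow> 'k) \<Rightarrow> 'k) \<Rightarrow> real" where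
  "inj_norm X Y u = Sup {norm (\<Sum>(x, y)\<leftarrow>ps. f x * g y) | ps f g.
     ps \<in> representations X Y u \<and>
     f \<in> dual X \<and> dual_norm X f \<le> 1 \<and> g \<in> dual Y \<and> dual_norm Y g \<le> 1}"

definition projective_tensor_product ::
    "('k::real_or_complex, 'a) normed \<Rightarrow> ('k, 'b) normed
      \<Rightarrow> ('k, (nat \<Rightarrow> ('a \<Rightarrow> 'b \<Rightarrow> 'k) \<Rightarrow> 'k) set) normed"
    (infixl \<open>\<otimes>\<^sub>\<pi>\<close> 70) where
  "X \<otimes>\<^sub>\<pi> Y = completion (tensor_space X Y (proj_norm X Y))"

definition injective_tensor_product ::
    "('k::real_or_complex, 'a) normed \<Rightarrow> ('k, 'b) normed
      \<Rightarrow> ('k, (nat \<Rightarrow> ('a \<Rightarrow> 'b \<Rightarrow> 'k) \<Rightarrow> 'k) set) normed"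
    (infixl \<open>\<otimes>\<^sub>\<epsilon>\<close> 70) where
  "X \<otimes>\<^sub>\<epsilon> Y = completion (tensor_space X Y (inj_norm X Y))"

end

theory Submission
  imports Defs
begin

text \<open>
  An operator \<open>T\<close> on \<open>X\<close> of norm \<open>1\<close> induces the operator \<open>T \<otimes> I\<close> on a tensor product, again
  of norm \<open>1\<close>, and the point is that its numerical radius is at most that of \<open>T\<close>. Taking the infimum
  over \<open>T\<close> gives the bound by the index of \<open>X\<close>, and \<open>I \<otimes> S\<close> gives the bound by the index of \<open>Y\<close>.

  The numerical radius of an operator is not directly visible on a tensor product, whose dual and
  whose norm-one vectors are complicated. It is, however, controlled by operator norms alone: it is the
  growth rate of \<open>\<parallel>I + c T\<parallel>\<close> as the scalar \<open>c\<close> tends to \<open>0\<close>, maximised over the directions of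
  \<open>c\<close>. Since \<open>I + c (T \<otimes> I) = (I + c T) \<otimes> I\<close> has norm at most \<open>\<parallel>I + c T\<parallel>\<close>, the
  growth rate does not increase (\<open>numerical_radius_transfer\<close>).

  That the growth rate of \<open>\<parallel>I + c T\<parallel>\<close> is at most the numerical radius \<open>v\<close> of \<open>T\<close> is an argument of
  Lumer (\<open>bounded_by_id_add_numerical_radius\<close>). A functional supporting \<open>x\<close> shows
  \<open>(1 - \<bar>c\<bar> v) \<parallel>x\<parallel> \<le> \<parallel>x - c T x\<parallel>\<close>. For \<open>x = y + c T y\<close> the right-hand side is
  \<open>\<parallel>y - c\<^sup>2 T\<^sup>2 y\<parallel>\<close>, so \<open>\<parallel>I + c T\<parallel>\<close> is at most \<open>(1 + \<bar>c\<bar>\<^sup>2 \<parallel>T\<parallel>\<^sup>2) / (1 - \<bar>c\<bar> v)\<close>, that is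
  \<open>1 + \<bar>c\<bar> v\<close> up to terms of second order. Support functionals come from a form of the Hahn-Banach theorem
  proved by minimising sublinear functionals (\<open>exists_support_functional\<close>).

  What the two tensor norms have in common is that they are uniform crossnorms: \<open>x \<otimes> y\<close> has norm
  \<open>\<parallel>x\<parallel> \<parallel>y\<parallel>\<close>, and \<open>T \<otimes> S\<close> has norm at most \<open>\<parallel>T\<parallel> \<parallel>S\<parallel>\<close>. The theorem is therefore proved for any
  uniform crossnorm (\<open>numerical_index_completion_tensor_space_le\<close>) and then specialised.
\<close>

section \<open>Seminormed spaces\<close>

lemma scalar_space_simps [simp]:
  "carrier scalar_space = UNIV"
  "a \<otimes>\<^bsub>scalar_space\<^esub> b = a * b"
  "\<one>\<^bsub>scalar_space\<^esub> = 1"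
  "\<zero>\<^bsub>scalar_space\<^esub> = 0"
  "a \<oplus>\<^bsub>scalar_space\<^esub> b = a + b"
  "a \<odot>\<^bsub>scalar_space\<^esub> b = a * b"
  "nrm scalar_space a = norm a"
  by (simp_all add: scalar_space_def)

lemma cring_scalar_space: "cring (scalar_space :: ('k::real_or_complex, 'k) normed)"
proof (rule cringI)
  show "abelian_group (scalar_space :: ('k, 'k) normed)"
    by (rule abelian_groupI) (auto simp: algebra_simps intro: exI[of _ "- x" for x])
  show "Group.comm_monoid (scalar_space :: ('k, 'k) normed)"
    by (rule comm_monoidI) (auto simp: algebra_simps)
qed (auto simp: algebra_simps)

lemma minus_scalar_space [simp]: "\<ominus>\<^bsub>scalar_space\<^esub> a = - (a :: 'k::real_or_complex)"
proof -
  interpret cring "scalar_space :: ('k, 'k) normed" by (rule cring_scalar_space)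
  show ?thesis by (rule minus_equality) auto
qed

text \<open>
  A completion identifies sequences at distance \<open>0\<close>, so it turns any seminorm into a norm. Stating
  everything before the completion for seminorms makes it apply to tensor norms directly.
\<close>

locale seminormed_space =
  fixes X :: "('k::real_or_complex, 'v) normed" (structure)
  assumes module: "module scalar_space X"
    and nrm_add_le: "x \<in> carrier X \<Longrightarrow> y \<in> carrier X \<Longrightarrow> nrm X (x \<oplus> y) \<le> nrm X x + nrm X y"
    and nrm_smult: "x \<in> carrier X \<Longrightarrow> nrm X (c \<odot> x) = norm c * nrm X x"

sublocale seminormed_space \<subseteq> V: module scalar_space X
  by (rule module)

sublocale normed_space \<subseteq> seminormed?: seminormed_space X
  by (intro seminormed_space.intro module nrm_add_le nrm_smult)

lemma seminormed_spaceI: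
  fixes X :: "('k::real_or_complex, 'v) normed" (structure)
  assumes "\<And>x y. x \<in> carrier X \<Longrightarrow> y \<in> carrier X \<Longrightarrow> x \<oplus> y \<in> carrier X"
    and "\<zero> \<in> carrier X"
    and smult_closed: "\<And>c x. x \<in> carrier X \<Longrightarrow> c \<odot> x \<in> carrier X"
    and "\<And>x y z. x \<in> carrier X \<Longrightarrow> y \<in> carrier X \<Longrightarrow> z \<in> carrier X \<Longrightarrow>
      x \<oplus> y \<oplus> z = x \<oplus> (y \<oplus> z)"
    and "\<And>x y. x \<in> carrier X \<Longrightarrow> y \<in> carrier X \<Longrightarrow> x \<oplus> y = y \<oplus> x"
    and "\<And>x. x \<in> carrier X \<Longrightarrow> \<zero> \<oplus> x = x"
    and l_null: "\<And>x. x \<in> carrier X \<Longrightarrow> 0 \<odot> x = \<zero>"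
    and l_distr: "\<And>a b x. x \<in> carrier X \<Longrightarrow> (a + b) \<odot> x = a \<odot> x \<oplus> b \<odot> x"
    and "\<And>a x y. x \<in> carrier X \<Longrightarrow> y \<in> carrier X \<Longrightarrow> a \<odot> (x \<oplus> y) = a \<odot> x \<oplus> a \<odot> y"
    and "\<And>a b x. x \<in> carrier X \<Longrightarrow> (a * b) \<odot> x = a \<odot> (b \<odot> x)"
    and smult_one: "\<And>x. x \<in> carrier X \<Longrightarrow> 1 \<odot> x = x"
    and "\<And>x y. x \<in> carrier X \<Longrightarrow> y \<in> carrier X \<Longrightarrow> nrm X (x \<oplus> y) \<le> nrm X x + nrm X y"
    and "\<And>c x. x \<in> carrier X \<Longrightarrow> nrm X (c \<odot> x) = norm c * nrm X x"
  shows "seminormed_space X"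
proof (rule seminormed_space.intro)
  have neg: "\<exists>y\<in>carrier X. y \<oplus> x = \<zero>" if "x \<in> carrier X" for x
    using that l_distr[of x "- 1" 1] by (intro bexI[of _ "(- 1) \<odot> x"]) (auto simp: assms)
  have "abelian_group X"
    by (rule abelian_groupI) (auto intro: assms neg)
  then show "module scalar_space X"
    by (intro moduleI cring_scalar_space) (auto intro: assms)
qed (auto intro: assms)

lemma normed_spaceI:
  assumes "seminormed_space X"
    and "\<And>x. x \<in> carrier X \<Longrightarrow> nrm X x = 0 \<Longrightarrow> x = \<zero>\<^bsub>X\<^esub>"
  shows "normed_space X"
proof -
  interpret seminormed_space X by fact
  have "nrm X \<zero>\<^bsub>X\<^esub> = 0"
    using nrm_smult[of "\<zero>\<^bsub>X\<^esub>" 0] V.smult_l_null[of "\<zero>\<^bsub>X\<^esub>"] by simp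
  with assms(2) show ?thesis
    by (intro normed_space.intro module nrm_add_le nrm_smult) auto
qed

context seminormed_space
begin

lemma smult_closed [simp, intro]: "x \<in> carrier X \<Longrightarrow> c \<odot> x \<in> carrier X"
  by (rule V.smult_closed) auto

lemma smult_add_left: "x \<in> carrier X \<Longrightarrow> (a + b) \<odot> x = a \<odot> x \<oplus> b \<odot> x"
  using V.smult_l_distr[of a b x] by simp

lemma smult_add_right:
  "x \<in> carrier X \<Longrightarrow> y \<in> carrier X \<Longrightarrow> a \<odot> (x \<oplus> y) = a \<odot> x \<oplus> a \<odot> y"
  using V.smult_r_distr[of a x y] by simp

lemma smult_smult [simp]: "x \<in> carrier X \<Longrightarrow> a \<odot> (b \<odot> x) = (a * b) \<odot> x"
  using V.smult_assoc1[of a b x] by simp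

lemma smult_1 [simp]: "x \<in> carrier X \<Longrightarrow> 1 \<odot> x = x"
  using V.smult_one[of x] by simp

lemma smult_0 [simp]: "x \<in> carrier X \<Longrightarrow> 0 \<odot> x = \<zero>"
  using V.smult_l_null[of x] by simp

lemma smult_uminus_left [simp]: "x \<in> carrier X \<Longrightarrow> (- c) \<odot> x = \<ominus> (c \<odot> x)"
  using V.smult_l_minus[of c x] by simp

lemma smult_uminus_right [simp]: "x \<in> carrier X \<Longrightarrow> c \<odot> (\<ominus> x) = \<ominus> (c \<odot> x)"
  using V.smult_r_minus[of c x] by simp

lemma smult_diff_right:
  "x \<in> carrier X \<Longrightarrow> y \<in> carrier X \<Longrightarrow> a \<odot> (x \<ominus> y) = a \<odot> x \<ominus> a \<odot> y"
  by (simp add: a_minus_def smult_add_right)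

lemma diff_self [simp]: "x \<in> carrier X \<Longrightarrow> x \<ominus> x = \<zero>"
  by (simp add: a_minus_def V.M.r_neg)

lemma diff_zero [simp]: "x \<in> carrier X \<Longrightarrow> x \<ominus> \<zero> = x"
  by (simp add: a_minus_def)

lemma add_diff_add:
  assumes "x \<in> carrier X" "y \<in> carrier X" "x' \<in> carrier X" "y' \<in> carrier X"
  shows "(x \<oplus> y) \<ominus> (x' \<oplus> y') = (x \<ominus> x') \<oplus> (y \<ominus> y')"
  using assms by (simp add: a_minus_def V.minus_add V.a_ac)

lemma diff_trans:
  assumes "x \<in> carrier X" "y \<in> carrier X" "z \<in> carrier X"
  shows "(x \<ominus> y) \<oplus> (y \<ominus> z) = x \<ominus> z"
proof -
  have "(x \<ominus> y) \<oplus> (y \<ominus> z) = x \<oplus> ((\<ominus> y \<oplus> y) \<oplus> \<ominus> z)"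
    using assms by (simp add: a_minus_def V.a_assoc del: V.M.l_neg)
  then show ?thesis using assms by (simp add: a_minus_def V.M.l_neg)
qed

lemma nrm_zero [simp]: "nrm X \<zero> = 0"
  using nrm_smult[of \<zero> 0] by simp

lemma nrm_uminus [simp]: "x \<in> carrier X \<Longrightarrow> nrm X (\<ominus> x) = nrm X x"
  using nrm_smult[of x "- 1"] by simp

lemma nrm_nonneg [simp]: "x \<in> carrier X \<Longrightarrow> 0 \<le> nrm X x"
  using nrm_add_le[of x "\<ominus> x"] by (simp add: V.M.r_neg)

lemma nrm_diff_commute: 
  assumes "x \<in> carrier X" "y \<in> carrier X" shows "nrm X (x \<ominus> y) = nrm X (y \<ominus> x)"
proof -
  have "x \<ominus> y = \<ominus> (y \<ominus> x)"
    using assms by (simp add: a_minus_def V.minus_add V.a_comm)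
  with assms show ?thesis by simp
qed

lemma nrm_diff_le:
  "x \<in> carrier X \<Longrightarrow> y \<in> carrier X \<Longrightarrow> nrm X (x \<ominus> y) \<le> nrm X x + nrm X y"
  using nrm_add_le[of x "\<ominus> y"] by (simp add: a_minus_def)

lemma nrm_triangle_diff:
  "x \<in> carrier X \<Longrightarrow> y \<in> carrier X \<Longrightarrow> z \<in> carrier X \<Longrightarrow>
    nrm X (x \<ominus> z) \<le> nrm X (x \<ominus> y) + nrm X (y \<ominus> z)"
  using nrm_add_le[of "x \<ominus> y" "y \<ominus> z"] by (simp add: diff_trans)

lemma nrm_reverse_triangle:
  assumes "x \<in> carrier X" "y \<in> carrier X"
  shows "\<bar>nrm X x - nrm X y\<bar> \<le> nrm X (x \<ominus> y)"
  using nrm_triangle_diff[of x y \<zero>] nrm_triangle_diff[of y x \<zero>] nrm_diff_commute[of x y] assms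
  by simp

end

lemma normed_scalar_space: "normed_space (scalar_space :: ('k::real_or_complex, 'k) normed)"
  by (intro normed_spaceI seminormed_spaceI) (auto simp: algebra_simps norm_triangle_ineq norm_mult)

interpretation scalar: normed_space "scalar_space :: ('k::real_or_complex, 'k) normed"
  by (rule normed_scalar_space)

section \<open>Bounded operators\<close>

lemma linear_mapsI:
  assumes "\<And>x. x \<in> carrier X \<Longrightarrow> T x \<in> carrier Y"
    and "\<And>x y. x \<in> carrier X \<Longrightarrow> y \<in> carrier X \<Longrightarrow> T (x \<oplus>\<^bsub>X\<^esub> y) = T x \<oplus>\<^bsub>Y\<^esub> T y"
    and "\<And>c x. x \<in> carrier X \<Longrightarrow> T (c \<odot>\<^bsub>X\<^esub> x) = c \<odot>\<^bsub>Y\<^esub> T x"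
  shows "T \<in> linear_maps X Y"
  using assms by (auto simp: linear_maps_def)

lemma linear_mapsD:
  assumes "T \<in> linear_maps X Y"
  shows "x \<in> carrier X \<Longrightarrow> T x \<in> carrier Y"
    and "x \<in> carrier X \<Longrightarrow> y \<in> carrier X \<Longrightarrow> T (x \<oplus>\<^bsub>X\<^esub> y) = T x \<oplus>\<^bsub>Y\<^esub> T y"
    and "x \<in> carrier X \<Longrightarrow> T (c \<odot>\<^bsub>X\<^esub> x) = c \<odot>\<^bsub>Y\<^esub> T x"
  using assms by (auto simp: linear_maps_def)

lemma linear_maps_comp:
  assumes "T \<in> linear_maps X Y" "S \<in> linear_maps Y Z"
  shows "(\<lambda>x. S (T x)) \<in> linear_maps X Z"
  using assms by (auto simp: linear_maps_def Pi_iff)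

lemma linear_maps_id: "(\<lambda>x. x) \<in> linear_maps X X"
  by (simp add: linear_maps_def)

text \<open>
  The operator norm is a supremum and says something about \<open>T\<close> only if \<open>T\<close> is bounded. Estimates
  are therefore carried as explicit bounds, which compose and pass to completions.
\<close>

definition bounded_by :: "('k, 'v) normed \<Rightarrow> ('k, 'w) normed \<Rightarrow> ('v \<Rightarrow> 'w) \<Rightarrow> real \<Rightarrow> bool" where
  "bounded_by X Y T C \<longleftrightarrow> T \<in> linear_maps X Y \<and> 0 \<le> C \<and>
     (\<forall>x\<in>carrier X. nrm Y (T x) \<le> C * nrm X x)"

lemma bounded_byI:
  assumes "T \<in> linear_maps X Y" "0 \<le> C" "\<And>x. x \<in> carrier X \<Longrightarrow> nrm Y (T x) \<le> C * nrm X x"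
  shows "bounded_by X Y T C"
  using assms by (auto simp: bounded_by_def)

lemma bounded_byD:
  assumes "bounded_by X Y T C"
  shows "T \<in> linear_maps X Y" "0 \<le> C" "x \<in> carrier X \<Longrightarrow> nrm Y (T x) \<le> C * nrm X x"
  using assms by (auto simp: bounded_by_def)

lemma bounded_by_imp_bounded_ops: "bounded_by X Y T C \<Longrightarrow> T \<in> bounded_ops X Y"
  by (auto simp: bounded_by_def bounded_ops_def)

lemma bounded_ops_imp_linear_maps: "T \<in> bounded_ops X Y \<Longrightarrow> T \<in> linear_maps X Y"
  by (simp add: bounded_ops_def)

lemma bounded_by_id:
  shows "bounded_by X X (\<lambda>x. x) 1"
  by (rule bounded_byI) (auto intro: linear_maps_id)

lemma bounded_by_comp:
  assumes "bounded_by X Y T C" "bounded_by Y Z S D"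
  shows "bounded_by X Z (\<lambda>x. S (T x)) (D * C)"
proof (rule bounded_byI)
  fix x assume x: "x \<in> carrier X"
  note T = bounded_byD[OF assms(1)] and S = bounded_byD[OF assms(2)]
  have "nrm Z (S (T x)) \<le> D * nrm Y (T x)"
    using S(3) linear_mapsD(1)[OF T(1) x] .
  also have "\<dots> \<le> D * (C * nrm X x)"
    using T(3)[OF x] S(2) by (rule mult_left_mono)
  finally show "nrm Z (S (T x)) \<le> D * C * nrm X x" by (simp add: mult.assoc)
qed (use assms in \<open>auto simp: bounded_by_def intro: linear_maps_comp\<close>)

locale seminormed_pair = X: seminormed_space X + Y: seminormed_space Y
  for X :: "('k::real_or_complex, 'v) normed" and Y :: "('k, 'w) normed"
begin

lemma op_norm_le:
  assumes "bounded_by X Y T C"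
  shows "op_norm X Y T \<le> C"
  unfolding op_norm_def
proof (rule cSup_least)
  show "{nrm Y (T x) |x. x \<in> carrier X \<and> nrm X x \<le> 1} \<noteq> {}"
    by (auto intro!: exI[of _ "\<zero>\<^bsub>X\<^esub>"])
  fix r assume "r \<in> {nrm Y (T x) |x. x \<in> carrier X \<and> nrm X x \<le> 1}"
  then obtain x where x: "x \<in> carrier X" "nrm X x \<le> 1" "r = nrm Y (T x)" by auto
  then have "r \<le> C * nrm X x" using bounded_byD(3)[OF assms] by simp
  also have "\<dots> \<le> C" using x bounded_byD(2)[OF assms] by (simp add: mult_left_le)
  finally show "r \<le> C" .
qed

lemma le_op_norm_if_unit:
  assumes T: "T \<in> bounded_ops X Y" and "x \<in> carrier X" "nrm X x \<le> 1"
  shows "nrm Y (T x) \<le> op_norm X Y T"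
  unfolding op_norm_def
proof (rule cSup_upper)
  show "nrm Y (T x) \<in> {nrm Y (T x) |x. x \<in> carrier X \<and> nrm X x \<le> 1}" using assms by auto
  obtain C where C: "\<And>x. x \<in> carrier X \<Longrightarrow> nrm Y (T x) \<le> C * nrm X x"
    using T by (auto simp: bounded_ops_def)
  have "nrm Y (T x) \<le> \<bar>C\<bar>" if "x \<in> carrier X" "nrm X x \<le> 1" for x
  proof -
    have "nrm Y (T x) \<le> \<bar>C\<bar> * nrm X x"
      using C[OF that(1)] that by (meson X.nrm_nonneg abs_ge_self mult_right_mono order_trans)
    then show ?thesis using that by (meson abs_ge_zero mult_left_le order_trans)
  qed
  then show "bdd_above {nrm Y (T x) |x. x \<in> carrier X \<and> nrm X x \<le> 1}"
    by (intro bdd_aboveI) auto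
qed

lemma op_norm_nonneg:
  assumes "T \<in> bounded_ops X Y" shows "0 \<le> op_norm X Y T"
proof -
  have "T \<zero>\<^bsub>X\<^esub> \<in> carrier Y"
    using assms by (auto intro: linear_mapsD bounded_ops_imp_linear_maps)
  then have "0 \<le> nrm Y (T \<zero>\<^bsub>X\<^esub>)" by simp
  also have "\<dots> \<le> op_norm X Y T" using assms by (intro le_op_norm_if_unit) auto
  finally show ?thesis .
qed

lemma bounded_by_op_norm:
  assumes T: "T \<in> bounded_ops X Y"
  shows "bounded_by X Y T (op_norm X Y T)"
proof (rule bounded_byI)
  show lin: "T \<in> linear_maps X Y" using T by (rule bounded_ops_imp_linear_maps)
  fix x assume x: "x \<in> carrier X"
  show "nrm Y (T x) \<le> op_norm X Y T * nrm X x"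
  proof (cases "nrm X x = 0")
    case True
    then show ?thesis using T x by (auto simp: bounded_ops_def)
  next
    case False
    then have pos: "0 < nrm X x" using X.nrm_nonneg[OF x] by simp
    let ?c = "of_real (1 / nrm X x) :: 'k"
    have "nrm Y (T (?c \<odot>\<^bsub>X\<^esub> x)) \<le> op_norm X Y T"
      using T x pos by (intro le_op_norm_if_unit) (auto simp: X.nrm_smult norm_divide)
    moreover have "nrm Y (T (?c \<odot>\<^bsub>X\<^esub> x)) = nrm Y (T x) / nrm X x"
      using x pos linear_mapsD[OF lin] by (simp add: Y.nrm_smult norm_divide)
    ultimately have "nrm Y (T x) / nrm X x \<le> op_norm X Y T" by simp
    with pos show ?thesis by (simp add: pos_divide_le_eq)
  qed
qed (rule op_norm_nonneg[OF T])

end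

context seminormed_space
begin

lemma pair: "seminormed_pair X X"
  by unfold_locales

lemma pair_scalar: "seminormed_pair X (scalar_space :: ('k, 'k) normed)"
  by unfold_locales

lemma bounded_by_zero: "bounded_by X (scalar_space :: ('k, 'k) normed) (\<lambda>_. 0) 1"
  by (intro bounded_byI linear_mapsI) auto

lemma exists_unit:
  assumes "x \<in> carrier X" "nrm X x \<noteq> 0"
  obtains c where "nrm X (c \<odot> x) = 1"
proof
  show "nrm X (of_real (1 / nrm X x) \<odot> x) = 1"
    using assms by (simp add: nrm_smult norm_divide)
qed

lemma bounded_by_id_add:
  assumes "bounded_by X X T C"
  shows "bounded_by X X (\<lambda>x. x \<oplus> c \<odot> T x) (1 + norm c * C)"
proof (rule bounded_byI)
  note T = bounded_byD[OF assms] and L = linear_mapsD[OF bounded_byD(1)[OF assms]]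
  show "(\<lambda>x. x \<oplus> c \<odot> T x) \<in> linear_maps X X"
    by (rule linear_mapsI) (auto simp: L smult_add_right V.a_ac mult.commute)
  show "0 \<le> 1 + norm c * C" using T by simp
  fix x assume x: "x \<in> carrier X"
  have "nrm X (x \<oplus> c \<odot> T x) \<le> nrm X x + norm c * nrm X (T x)"
    using nrm_add_le[of x "c \<odot> T x"] L(1)[OF x] x by (simp add: nrm_smult)
  also have "\<dots> \<le> nrm X x + norm c * (C * nrm X x)"
    using T(3)[OF x] by (intro add_left_mono mult_left_mono) auto
  finally show "nrm X (x \<oplus> c \<odot> T x) \<le> (1 + norm c * C) * nrm X x"
    by (simp add: algebra_simps)
qed

end

section \<open>Support functionals\<close>

text \<open>
  The instance of the Hahn-Banach theorem at stake: every vector \<open>x\<close> has a functional of norm at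
  most \<open>1\<close> with value \<open>nrm X x\<close> at \<open>x\<close>. Instead of extending functionals from
  subspaces, one shrinks sublinear functionals below the norm: a minimal one is linear. All
  functionals then live on the whole space, and Zorn's lemma is applied to functions with a fixed
  domain. The value \<open>0\<close> off the carrier identifies functionals that agree on the carrier.
\<close>

context seminormed_space
begin

definition sublinear_minorants :: "('v \<Rightarrow> real) set" where
  "sublinear_minorants = {p.
     (\<forall>x\<in>carrier X. \<forall>y\<in>carrier X. p (x \<oplus> y) \<le> p x + p y) \<and>
     (\<forall>r\<ge>0. \<forall>x\<in>carrier X. p (of_real r \<odot> x) = r * p x) \<and>
     (\<forall>x\<in>carrier X. p x \<le> nrm X x) \<and> (\<forall>x. x \<notin> carrier X \<longrightarrow> p x = 0)}"

text \<open>
  Homogeneity follows from one inequality, since a scaling by \<open>r > 0\<close> can be undone.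
\<close>

lemma sublinear_minorantsI:
  assumes add: "\<And>x y. x \<in> carrier X \<Longrightarrow> y \<in> carrier X \<Longrightarrow> p (x \<oplus> y) \<le> p x + p y"
    and zero: "p \<zero> = 0"
    and scale: "\<And>r x. 0 < r \<Longrightarrow> x \<in> carrier X \<Longrightarrow> p (of_real r \<odot> x) \<le> r * p x"
    and le: "\<And>x. x \<in> carrier X \<Longrightarrow> p x \<le> nrm X x"
    and off: "\<And>x. x \<notin> carrier X \<Longrightarrow> p x = 0"
  shows "p \<in> sublinear_minorants"
proof -
  have "p (of_real r \<odot> x) = r * p x" if "0 \<le> r" and x: "x \<in> carrier X" for r x
  proof (cases "r = 0")
    case False
    with \<open>0 \<le> r\<close> have r: "0 < r" by simp
    have "p x \<le> 1 / r * p (of_real r \<odot> x)"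
      using scale[of "1 / r" "of_real r \<odot> x"] r x by (simp flip: of_real_mult)
    then have "r * p x \<le> p (of_real r \<odot> x)" using r by (simp add: field_simps)
    with scale[OF r x] show ?thesis by simp
  qed (use x zero in simp)
  then show ?thesis using assms by (auto simp: sublinear_minorants_def)
qed

lemma sublinear_minorantsD:
  assumes "p \<in> sublinear_minorants"
  shows "x \<in> carrier X \<Longrightarrow> y \<in> carrier X \<Longrightarrow> p (x \<oplus> y) \<le> p x + p y"
    and "0 \<le> r \<Longrightarrow> x \<in> carrier X \<Longrightarrow> p (of_real r \<odot> x) = r * p x"
    and "x \<in> carrier X \<Longrightarrow> p x \<le> nrm X x"
    and "x \<notin> carrier X \<Longrightarrow> p x = 0"
    and "p \<zero> = 0"
    and "x \<in> carrier X \<Longrightarrow> - p (\<ominus> x) \<le> p x"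
    and "x \<in> carrier X \<Longrightarrow> - nrm X x \<le> p x"
proof -
  show add: "p (x \<oplus> y) \<le> p x + p y" if "x \<in> carrier X" "y \<in> carrier X" for x y
    using assms that by (auto simp: sublinear_minorants_def)
  show hom: "p (of_real r \<odot> x) = r * p x" if "0 \<le> r" "x \<in> carrier X" for r x
    using assms that by (auto simp: sublinear_minorants_def)
  show le: "p x \<le> nrm X x" if "x \<in> carrier X" for x
    using assms that by (auto simp: sublinear_minorants_def)
  show "p x = 0" if "x \<notin> carrier X"
    using assms that by (auto simp: sublinear_minorants_def)
  show zero: "p \<zero> = 0" using hom[of 0 \<zero>] by simp
  show neg: "- p (\<ominus> x) \<le> p x" if "x \<in> carrier X" for x
    using add[of x "\<ominus> x"] that zero by (simp add: V.M.r_neg)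
  show "- nrm X x \<le> p x" if "x \<in> carrier X"
    using neg[OF that] le[of "\<ominus> x"] that by simp
qed

lemma nrm_sublinear_minorant: "(\<lambda>x. if x \<in> carrier X then nrm X x else 0) \<in> sublinear_minorants"
  by (rule sublinear_minorantsI) (auto simp: nrm_smult nrm_add_le)

text \<open>
  The largest sublinear functional below \<open>p\<close> whose value at \<open>- y\<close> is \<open>- p y\<close>.
\<close>

definition shrink :: "('v \<Rightarrow> real) \<Rightarrow> 'v \<Rightarrow> 'v \<Rightarrow> real" where
  "shrink p y x = (if x \<in> carrier X then INF t\<in>{0..}. p (x \<oplus> of_real t \<odot> y) - t * p y else 0)"

lemma shrink_le:
  assumes p: "p \<in> sublinear_minorants" and "x \<in> carrier X" "y \<in> carrier X" "0 \<le> t"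
  shows "shrink p y x \<le> p (x \<oplus> of_real t \<odot> y) - t * p y"
proof -
  note P = sublinear_minorantsD[OF p]
  have "- p (\<ominus> x) \<le> p (x \<oplus> of_real s \<odot> y) - s * p y" if "0 \<le> s" for s
  proof -
    have "of_real s \<odot> y = \<ominus> x \<oplus> (x \<oplus> of_real s \<odot> y)"
      using assms by (simp add: V.M.r_neg1)
    then have "s * p y \<le> p (\<ominus> x) + p (x \<oplus> of_real s \<odot> y)"
      using P(1)[of "\<ominus> x" "x \<oplus> of_real s \<odot> y"] P(2)[OF that \<open>y \<in> carrier X\<close>] assms by simp
    then show ?thesis by simp
  qed
  then have "bdd_below ((\<lambda>t. p (x \<oplus> of_real t \<odot> y) - t * p y) ` {0..})"
    by (intro bdd_belowI) auto
  then show ?thesis using assms by (auto simp: shrink_def intro!: cINF_lower2)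
qed

lemma le_shrink:
  assumes "x \<in> carrier X" "\<And>t. 0 \<le> t \<Longrightarrow> a \<le> p (x \<oplus> of_real t \<odot> y) - t * p y"
  shows "a \<le> shrink p y x"
  using assms by (auto simp: shrink_def intro!: cINF_greatest)

lemma shrink_sublinear_minorant:
  assumes p: "p \<in> sublinear_minorants" and y: "y \<in> carrier X"
  shows "shrink p y \<in> sublinear_minorants"
    and "x \<in> carrier X \<Longrightarrow> shrink p y x \<le> p x"
    and "shrink p y (\<ominus> y) \<le> - p y"
proof -
  note P = sublinear_minorantsD[OF p]
  show le: "shrink p y x \<le> p x" if "x \<in> carrier X" for x
    using shrink_le[OF p that y, of 0] that y by simp
  show "shrink p y (\<ominus> y) \<le> - p y"
    using shrink_le[OF p _ y, of "\<ominus> y" 1] y P(5) by (simp add: V.M.l_neg)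
  show "shrink p y \<in> sublinear_minorants"
  proof (rule sublinear_minorantsI)
    fix x x' assume x: "x \<in> carrier X" and x': "x' \<in> carrier X"
    have *: "shrink p y (x \<oplus> x') \<le>
        (p (x \<oplus> of_real s \<odot> y) - s * p y) + (p (x' \<oplus> of_real t \<odot> y) - t * p y)"
      if st: "0 \<le> s" "0 \<le> t" for s t
    proof -
      have "x \<oplus> x' \<oplus> of_real (s + t) \<odot> y = (x \<oplus> of_real s \<odot> y) \<oplus> (x' \<oplus> of_real t \<odot> y)"
        using x x' y by (simp add: smult_add_left V.a_ac)
      then have "p (x \<oplus> x' \<oplus> of_real (s + t) \<odot> y) \<le> p (x \<oplus> of_real s \<odot> y) + p (x' \<oplus> of_real t \<odot> y)"
        using P(1)[of "x \<oplus> of_real s \<odot> y" "x' \<oplus> of_real t \<odot> y"] x x' y by simp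
      moreover have "shrink p y (x \<oplus> x') \<le> p (x \<oplus> x' \<oplus> of_real (s + t) \<odot> y) - (s + t) * p y"
        using x x' y st by (intro shrink_le[OF p]) auto
      ultimately show ?thesis by (simp add: algebra_simps)
    qed
    have "shrink p y (x \<oplus> x') - shrink p y x \<le> p (x' \<oplus> of_real t \<odot> y) - t * p y" if "0 \<le> t" for t
    proof -
      have "shrink p y (x \<oplus> x') - (p (x' \<oplus> of_real t \<odot> y) - t * p y) \<le> shrink p y x"
        using *[OF _ that] by (intro le_shrink[OF x]) (simp add: algebra_simps)
      then show ?thesis by simp
    qed
    then have "shrink p y (x \<oplus> x') - shrink p y x \<le> shrink p y x'" by (rule le_shrink[OF x'])
    then show "shrink p y (x \<oplus> x') \<le> shrink p y x + shrink p y x'" by simp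
  next
    have "0 \<le> shrink p y \<zero>"
      using P(2)[OF _ y] y by (intro le_shrink) auto
    then show "shrink p y \<zero> = 0" using le[of \<zero>] P(5) by simp
  next
    fix r :: real and x assume r: "0 < r" and x: "x \<in> carrier X"
    have "shrink p y (of_real r \<odot> x) / r \<le> p (x \<oplus> of_real t \<odot> y) - t * p y" if t: "0 \<le> t" for t
    proof -
      have "of_real r \<odot> x \<oplus> of_real (r * t) \<odot> y = of_real r \<odot> (x \<oplus> of_real t \<odot> y)"
        using x y by (simp add: smult_add_right)
      then have "p (of_real r \<odot> x \<oplus> of_real (r * t) \<odot> y) = r * p (x \<oplus> of_real t \<odot> y)"
        using P(2)[of r "x \<oplus> of_real t \<odot> y"] r x y by simp
      moreover have "shrink p y (of_real r \<odot> x) \<le>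
          p (of_real r \<odot> x \<oplus> of_real (r * t) \<odot> y) - (r * t) * p y"
        using x y r t by (intro shrink_le[OF p]) auto
      ultimately show ?thesis using r by (simp add: field_simps)
    qed
    then have "shrink p y (of_real r \<odot> x) / r \<le> shrink p y x" by (rule le_shrink[OF x])
    then show "shrink p y (of_real r \<odot> x) \<le> r * shrink p y x" using r by (simp add: field_simps)
  next
    show "shrink p y x \<le> nrm X x" if "x \<in> carrier X" for x
      using le[OF that] P(3)[OF that] by simp
  qed (simp add: shrink_def)
qed

text \<open>
  Subadditivity of the infimum mixes values of two members of the chain; the smaller of the two
  bounds both.
\<close>

lemma chain_Inf_sublinear_minorant:
  assumes C: "C \<subseteq> sublinear_minorants" "C \<noteq> {}"
    and chain: "\<And>p q. p \<in> C \<Longrightarrow> q \<in> C \<Longrightarrow> p \<le> q \<or> q \<le> p"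
  shows "(\<lambda>x. INF p\<in>C. p x) \<in> sublinear_minorants"
    and "p \<in> C \<Longrightarrow> (\<lambda>x. INF p\<in>C. p x) \<le> p"
proof -
  let ?u = "\<lambda>x. INF p\<in>C. p x"
  have P: "p \<in> sublinear_minorants" if "p \<in> C" for p using that C by auto
  note P = sublinear_minorantsD[OF this]
  have "bdd_below ((\<lambda>p. p x) ` C)" for x
  proof (cases "x \<in> carrier X")
    case True
    then show ?thesis using P(7) by (intro bdd_belowI[of _ "- nrm X x"]) auto
  next
    case False
    then show ?thesis by (intro bdd_belowI2[of _ 0]) (rule eq_refl[OF P(4)[OF _ False, symmetric]])
  qed
  then have lower: "?u x \<le> p x" if "p \<in> C" for p x
    using that by (intro cINF_lower)
  then show "?u \<le> p" if "p \<in> C" using that by (auto simp: le_fun_def)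
  have greatest: "a \<le> ?u x" if "\<And>p. p \<in> C \<Longrightarrow> a \<le> p x" for a x
    using that C(2) by (intro cINF_greatest)
  show "?u \<in> sublinear_minorants"
  proof (rule sublinear_minorantsI)
    fix x y assume x: "x \<in> carrier X" and y: "y \<in> carrier X"
    have *: "?u (x \<oplus> y) \<le> p x + q y" if pq: "p \<in> C" "q \<in> C" for p q
    proof -
      obtain m where m: "m \<in> C" "m \<le> p" "m \<le> q" using chain[OF pq] pq by blast
      have "?u (x \<oplus> y) \<le> m x + m y" using lower[OF m(1)] P(1)[OF m(1) x y] by (rule order_trans)
      also have "\<dots> \<le> p x + q y" using m by (intro add_mono) (auto simp: le_fun_def)
      finally show ?thesis .
    qed
    have "?u (x \<oplus> y) - ?u x \<le> q y" if q: "q \<in> C" for q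
    proof -
      have "?u (x \<oplus> y) - q y \<le> ?u x"
        using *[OF _ q] by (intro greatest) (simp add: algebra_simps)
      then show ?thesis by simp
    qed
    then have "?u (x \<oplus> y) - ?u x \<le> ?u y" by (rule greatest)
    then show "?u (x \<oplus> y) \<le> ?u x + ?u y" by simp
  next
    have "(\<lambda>p. p \<zero>) ` C = {0}" using C(2) P(5) by force
    then show "?u \<zero> = 0" by simp
  next
    fix r :: real and x assume r: "0 < r" and x: "x \<in> carrier X"
    have "?u (of_real r \<odot> x) / r \<le> p x" if p: "p \<in> C" for p
      using lower[OF p, of "of_real r \<odot> x"] P(2)[OF p _ x, of r] r by (simp add: field_simps)
    then have "?u (of_real r \<odot> x) / r \<le> ?u x" by (rule greatest)
    then show "?u (of_real r \<odot> x) \<le> r * ?u x" using r by (simp add: field_simps)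
  next
    obtain p where p: "p \<in> C" using C(2) by auto
    show "?u x \<le> nrm X x" if "x \<in> carrier X" for x
      using lower[OF p, of x] P(3)[OF p that] by simp
  next
    fix x assume "x \<notin> carrier X"
    then have "(\<lambda>p. p x) ` C = {0}" using C(2) P(4) by force
    then show "?u x = 0" by simp
  qed
qed

text \<open>
  Minimality forces \<open>shrink p y = p\<close> for every \<open>y\<close>, so that \<open>p\<close> is odd, and an odd sublinear
  functional is linear. Shrinking the norm at \<open>x0\<close> before minimising fixes the value at \<open>x0\<close>.
\<close>

lemma exists_real_support_functional:
  assumes x0: "x0 \<in> carrier X"
  obtains p where
    "\<And>x y. x \<in> carrier X \<Longrightarrow> y \<in> carrier X \<Longrightarrow> p (x \<oplus> y) = p x + p y"
    "\<And>r x. x \<in> carrier X \<Longrightarrow> p (of_real r \<odot> x) = r * p x"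
    "\<And>x. x \<in> carrier X \<Longrightarrow> p x \<le> nrm X x"
    "p x0 = nrm X x0"
proof -
  define q where "q = shrink (\<lambda>x. if x \<in> carrier X then nrm X x else 0) x0"
  have q: "q \<in> sublinear_minorants" "q (\<ominus> x0) \<le> - nrm X x0"
    using shrink_sublinear_minorant[OF nrm_sublinear_minorant x0] x0 unfolding q_def by simp_all
  define A where "A = {p \<in> sublinear_minorants. p \<le> q}"
  have "\<exists>p\<in>A. \<forall>a\<in>A. p \<ge> a \<longrightarrow> a = p"
  proof (rule predicate_Zorn)
    show "partial_order_on A (relation_of (\<ge>) A)"
      by (auto simp: partial_order_on_def preorder_on_def refl_on_def trans_def antisym_def
          relation_of_def)
    fix C assume C: "C \<in> Chains (relation_of (\<ge>) A)"
    then have CA: "C \<subseteq> A" and chain: "\<And>p q. p \<in> C \<Longrightarrow> q \<in> C \<Longrightarrow> p \<le> q \<or> q \<le> p"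
      by (auto simp: Chains_def relation_of_def)
    show "\<exists>u\<in>A. \<forall>a\<in>C. u \<le> a"
    proof (cases "C = {}")
      case True
      then show ?thesis using q by (auto simp: A_def)
    next
      case False
      have sub: "C \<subseteq> sublinear_minorants" using CA by (auto simp: A_def)
      note u = chain_Inf_sublinear_minorant[OF sub False chain]
      obtain c where c: "c \<in> C" using False by auto
      have "(\<lambda>x. INF p\<in>C. p x) \<le> q" using u(2)[OF _ _ c] c CA by (auto simp: A_def intro: order_trans)
      then show ?thesis using u by (intro bexI[of _ "\<lambda>x. INF p\<in>C. p x"]) (auto simp: A_def)
    qed
  qed
  then obtain p where p: "p \<in> sublinear_minorants" "p \<le> q"
    and min: "\<And>a. a \<in> sublinear_minorants \<Longrightarrow> a \<le> p \<Longrightarrow> a = p"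
    unfolding A_def by (auto intro: order_trans)
  note P = sublinear_minorantsD[OF p(1)]
  have odd: "p (\<ominus> y) = - p y" if y: "y \<in> carrier X" for y
  proof -
    note S = shrink_sublinear_minorant[OF p(1) y]
    have "shrink p y \<le> p"
      using S(2) P(4) by (auto simp: le_fun_def shrink_def)
    then have "shrink p y = p" using S(1) by (intro min)
    then show ?thesis using S(3) P(6)[OF y] by simp
  qed
  show thesis
  proof
    fix x y assume xy: "x \<in> carrier X" "y \<in> carrier X"
    have "p (\<ominus> (x \<oplus> y)) \<le> p (\<ominus> x) + p (\<ominus> y)"
      using P(1)[of "\<ominus> x" "\<ominus> y"] xy by (simp add: V.minus_add)
    then show "p (x \<oplus> y) = p x + p y" using P(1)[OF xy] odd xy by simp
  next
    fix r :: real and x assume x: "x \<in> carrier X"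
    show "p (of_real r \<odot> x) = r * p x"
    proof (cases "0 \<le> r")
      case False
      then have "p (of_real (- r) \<odot> x) = - r * p x" using x by (intro P(2)) auto
      then show ?thesis using x odd[of "of_real r \<odot> x"] by simp
    qed (use P(2) x in simp)
  next
    have "p (\<ominus> x0) \<le> q (\<ominus> x0)" using p(2) by (simp add: le_fun_def)
    then show "p x0 = nrm X x0" using q(2) odd[OF x0] P(3)[OF x0] by simp
  qed (rule P(3))
qed

end

text \<open>
  In the complex case \<open>1\<close> and \<open>i\<close> are linearly independent over the reals, because \<open>-1\<close> is not a
  real square. Hence the coordinates are unique, and the norm formula holds for any given ones.
\<close>

lemma real_or_complex_cases:
  obtains (real) "\<And>z :: 'k::real_or_complex. \<exists>a. z = of_real a"
  | (complex) i :: "'k::real_or_complex" where "i * i = - 1" "\<And>z :: 'k::real_or_complex. \<exists>a b. z = of_real a + of_real b * i"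
      "\<And>a b. norm (of_real a + of_real b * i) = sqrt (a\<^sup>2 + b\<^sup>2)"
proof -
  consider "\<forall>z :: 'k. \<exists>a. z = a *\<^sub>R 1"
    | i :: 'k where "i * i = - 1"
      "\<forall>z. \<exists>a b. z = a *\<^sub>R 1 + b *\<^sub>R i \<and> norm z = sqrt (a\<^sup>2 + b\<^sup>2)"
    using real_or_complex[where ?'a = 'k] by blast
  then show thesis
  proof cases
    case 1
    then show thesis using real by (auto simp: of_real_def)
  next
    case 2
    have uniq: "a = a' \<and> b = b'"
      if "of_real a + of_real b * i = of_real a' + of_real b' * i" for a b a' b'
    proof -
      have eq: "of_real (a - a') = of_real (b' - b) * i" using that by (simp add: algebra_simps)
      then have "of_real (a - a') * of_real (a - a') = of_real (b' - b) * of_real (b' - b) * (i * i)"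
        by simp
      then have "of_real ((a - a')\<^sup>2 + (b' - b)\<^sup>2) = (0 :: 'k)"
        using 2(1) by (simp add: power2_eq_square)
      then have "(a - a')\<^sup>2 + (b' - b)\<^sup>2 = 0" unfolding of_real_eq_0_iff .
      then show ?thesis by (simp add: sum_power2_eq_zero_iff)
    qed
    have ex: "\<exists>a b. z = of_real a + of_real b * i \<and> norm z = sqrt (a\<^sup>2 + b\<^sup>2)" for z
      using 2(2) by (simp add: of_real_def)
    show thesis
    proof (rule complex[OF 2(1)])
      show "\<exists>a b. z = of_real a + of_real b * i" for z using ex by blast
      show "norm (of_real a + of_real b * i) = sqrt (a\<^sup>2 + b\<^sup>2)" for a b
        using ex[of "of_real a + of_real b * i"] uniq by metis
    qed
  qed
qed

lemma exists_phase:
  obtains c :: "'k::real_normed_field" where "norm c = 1" "c * w = of_real (norm w)"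
proof (cases "w = 0")
  case True
  then show thesis using that[of 1] by simp
next
  case False
  then show thesis using that[of "of_real (norm w) / w"] by (simp add: norm_divide)
qed

text \<open>
  Over the complex numbers, \<open>p\<close> is the real part of \<open>x \<mapsto> p x - i * p (i x)\<close>.
\<close>

theorem (in seminormed_space) exists_support_functional:
  assumes x0: "x0 \<in> carrier X"
  obtains f where "bounded_by X (scalar_space :: ('k, 'k) normed) f 1" "f x0 = of_real (nrm X x0)"
proof -
  obtain p where add: "\<And>x y. x \<in> carrier X \<Longrightarrow> y \<in> carrier X \<Longrightarrow> p (x \<oplus> y) = p x + p y"
    and hom: "\<And>r x. x \<in> carrier X \<Longrightarrow> p (of_real r \<odot> x) = r * p x"
    and le: "\<And>x. x \<in> carrier X \<Longrightarrow> p x \<le> nrm X x"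
    and p0: "p x0 = nrm X x0"
    using exists_real_support_functional[OF x0] by blast
  have neg: "p (\<ominus> x) = - p x" if "x \<in> carrier X" for x
    using hom[OF that, of "- 1"] that by simp
  have abs: "\<bar>p x\<bar> \<le> nrm X x" if "x \<in> carrier X" for x
    using le[OF that] le[of "\<ominus> x"] neg that by (simp add: abs_le_iff)
  show thesis
  proof (cases rule: real_or_complex_cases[where 'k = 'k])
    case real
    have "bounded_by X (scalar_space :: ('k, 'k) normed) (\<lambda>x. of_real (p x)) 1"
    proof (rule bounded_byI)
      show "(\<lambda>x. of_real (p x)) \<in> linear_maps X (scalar_space :: ('k, 'k) normed)"
      proof (rule linear_mapsI)
        fix c :: 'k and x assume "x \<in> carrier X"
        moreover obtain a where "c = of_real a" using real by blast
        ultimately show "of_real (p (c \<odot> x)) = c \<odot>\<^bsub>scalar_space\<^esub> (of_real (p x) :: 'k)"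
          by (simp add: hom)
      qed (simp_all add: add)
    qed (simp_all add: abs)
    then show thesis using that p0 by simp
  next
    case (complex i)
    define f where "f x = of_real (p x) + of_real (- p (i \<odot> x)) * i" for x
    have ii: "i * (i * z) = - z" for z
      using complex(1) by (metis mult.assoc mult_minus1)
    have lin: "f \<in> linear_maps X (scalar_space :: ('k, 'k) normed)"
    proof (rule linear_mapsI)
      fix c :: 'k and x assume x: "x \<in> carrier X"
      obtain a b where c: "c = of_real a + of_real b * i" using complex(2) by blast
      have c_x: "c \<odot> x = of_real a \<odot> x \<oplus> of_real b \<odot> (i \<odot> x)"
        using x by (simp add: c smult_add_left)
      have "i * c = of_real (- b) + of_real a * i"
        by (simp add: c algebra_simps ii)
      then have ic_x: "i \<odot> (c \<odot> x) = of_real (- b) \<odot> x \<oplus> of_real a \<odot> (i \<odot> x)"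
        using x by (simp only: smult_smult smult_closed smult_add_left)
      have "p (c \<odot> x) = a * p x + b * p (i \<odot> x)" using x by (simp only: c_x add hom smult_closed)
      moreover have "p (i \<odot> (c \<odot> x)) = - b * p x + a * p (i \<odot> x)"
        using x by (simp only: ic_x add hom smult_closed)
      ultimately have "f (c \<odot> x) = of_real (a * p x + b * p (i \<odot> x)) + of_real (b * p x - a * p (i \<odot> x)) * i"
        by (simp add: f_def)
      also have "\<dots> = c * f x"
        by (simp add: f_def c algebra_simps ii)
      finally show "f (c \<odot> x) = c \<odot>\<^bsub>scalar_space\<^esub> f x" by simp
    qed (simp_all add: f_def smult_add_right add algebra_simps)
    have real_le: "\<bar>p x\<bar> \<le> norm (f x)" for x
      unfolding f_def complex(3) by (simp add: real_le_rsqrt)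
    have "bounded_by X (scalar_space :: ('k, 'k) normed) f 1"
    proof (rule bounded_byI[OF lin])
      fix x assume x: "x \<in> carrier X"
      \<comment> \<open>Rotating \<open>f x\<close> to a nonnegative real number reduces the bound to that of \<open>p\<close>.\<close>
      obtain c where c: "norm c = 1" "c * f x = of_real (norm (f x))" by (rule exists_phase)
      have "f (c \<odot> x) = of_real (norm (f x))" using linear_mapsD(3)[OF lin x] c by simp
      then have "of_real (p (c \<odot> x) - norm (f x)) + of_real (- p (i \<odot> (c \<odot> x))) * i = 0"
        by (simp add: f_def algebra_simps)
      then have "sqrt ((p (c \<odot> x) - norm (f x))\<^sup>2 + (- p (i \<odot> (c \<odot> x)))\<^sup>2) = 0"
        using complex(3) by (metis norm_zero)
      then have "norm (f x) = p (c \<odot> x)" by (simp add: sum_power2_eq_zero_iff)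
      also have "\<dots> \<le> nrm X x" using le[of "c \<odot> x"] x c by (simp add: nrm_smult)
      finally show "nrm scalar_space (f x) \<le> 1 * nrm X x" by simp
    qed simp
    moreover have "f x0 = of_real (nrm X x0)"
    proof -
      \<comment> \<open>The real part of \<open>f x0\<close> already has the largest modulus allowed, so no imaginary part is left.\<close>
      have "sqrt ((nrm X x0)\<^sup>2 + (- p (i \<odot> x0))\<^sup>2) \<le> nrm X x0"
        using bounded_byD(3)[OF calculation x0] p0 by (simp only: f_def complex(3) scalar_space_simps mult_1_left)
      then have "(nrm X x0)\<^sup>2 + (- p (i \<odot> x0))\<^sup>2 \<le> (nrm X x0)\<^sup>2" by (rule sqrt_le_D)
      then have "p (i \<odot> x0) = 0" by simp
      then show ?thesis using p0 by (simp add: f_def)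
    qed
    ultimately show thesis by (rule that)
  qed
qed

lemma (in seminormed_space) dual_bounded_by:
  assumes "f \<in> dual X" shows "bounded_by X scalar_space f (dual_norm X f)"
  using seminormed_pair.bounded_by_op_norm[OF pair_scalar] assms
  by (simp add: dual_def dual_norm_def)

lemma (in seminormed_space) bounded_by_1_iff_dual:
  "bounded_by X scalar_space f 1 \<longleftrightarrow> f \<in> dual X \<and> dual_norm X f \<le> 1"
proof
  assume f: "bounded_by X scalar_space f 1"
  then show "f \<in> dual X \<and> dual_norm X f \<le> 1"
    using seminormed_pair.op_norm_le[OF pair_scalar f] bounded_by_imp_bounded_ops[OF f]
    by (simp add: dual_def dual_norm_def)
next
  assume f: "f \<in> dual X \<and> dual_norm X f \<le> 1"
  then have B: "bounded_by X scalar_space f (dual_norm X f)" by (simp add: dual_bounded_by)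
  show "bounded_by X scalar_space f 1"
  proof (rule bounded_byI)
    fix x assume x: "x \<in> carrier X"
    have "nrm scalar_space (f x) \<le> dual_norm X f * nrm X x" using B x by (rule bounded_byD)
    also have "\<dots> \<le> 1 * nrm X x" using f x by (intro mult_right_mono) auto
    finally show "nrm scalar_space (f x) \<le> 1 * nrm X x" .
  qed (use bounded_byD(1)[OF B] in simp_all)
qed

lemma (in seminormed_space) exists_normalised_support_functional:
  assumes "x \<in> carrier X" "nrm X x = 1"
  obtains f where "f \<in> dual X" "dual_norm X f = 1" "f x = 1"
proof -
  interpret S: seminormed_pair X "scalar_space :: ('k, 'k) normed" by (rule pair_scalar)
  obtain f where f: "bounded_by X (scalar_space :: ('k, 'k) normed) f 1" "f x = of_real (nrm X x)"
    using exists_support_functional[OF assms(1)] by blast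
  then have f_dual: "f \<in> dual X" and le: "dual_norm X f \<le> 1" by (simp_all add: bounded_by_1_iff_dual)
  have "1 \<le> dual_norm X f"
    using S.le_op_norm_if_unit[of f x] f_dual assms f(2) by (simp add: dual_norm_def dual_def)
  with le have "dual_norm X f = 1" by simp
  then show thesis using that[OF f_dual] assms f(2) by simp
qed

section \<open>The numerical radius\<close>

locale nontrivial_normed_space = normed_space +
  assumes nontrivial: "carrier X \<noteq> {\<zero>}"
begin

lemma exists_unit_vector:
  obtains x where "x \<in> carrier X" "nrm X x = 1"
proof -
  obtain x where x: "x \<in> carrier X" "x \<noteq> \<zero>" using nontrivial V.zero_closed by blast
  then obtain c where "nrm X (c \<odot> x) = 1" using exists_unit nrm_eq_zero_iff by metis
  then show thesis using that[of "c \<odot> x"] x by simp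
qed

lemma norm_le_numerical_radius:
  assumes "T \<in> bounded_ops X X" "x \<in> carrier X" "nrm X x = 1"
    and "f \<in> dual X" "dual_norm X f = 1" "f x = 1"
  shows "norm (f (T x)) \<le> numerical_radius X T"
  unfolding numerical_radius_def
proof (rule cSup_upper)
  have T: "bounded_by X X T (op_norm X X T)"
    using assms(1) by (rule seminormed_pair.bounded_by_op_norm[OF pair])
  have "norm (f (T x)) \<le> op_norm X X T"
    if "x \<in> carrier X" "nrm X x = 1" "f \<in> dual X" "dual_norm X f = 1" for x f
  proof -
    have "norm (f (T x)) \<le> nrm X (T x)"
      using bounded_byD(3)[OF dual_bounded_by[OF that(3)]] linear_mapsD(1)[OF bounded_byD(1)[OF T]] that
      by fastforce
    also have "\<dots> \<le> op_norm X X T" using bounded_byD(3)[OF T that(1)] that(2) by simp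
    finally show ?thesis .
  qed
  then show "bdd_above {norm (f (T x)) |x f. x \<in> carrier X \<and> nrm X x = 1 \<and> f \<in> dual X \<and>
      dual_norm X f = 1 \<and> f x = 1}"
    by (intro bdd_aboveI) auto
qed (use assms in auto)

lemma numerical_radius_nonneg:
  assumes "T \<in> bounded_ops X X" shows "0 \<le> numerical_radius X T"
proof -
  obtain x where x: "x \<in> carrier X" "nrm X x = 1" by (rule exists_unit_vector)
  then obtain f where "f \<in> dual X" "dual_norm X f = 1" "f x = 1"
    by (rule exists_normalised_support_functional)
  then have "norm (f (T x)) \<le> numerical_radius X T"
    using x assms by (intro norm_le_numerical_radius)
  then show ?thesis using norm_ge_zero order_trans by blast
qed

lemma numerical_radius_le:
  assumes "\<And>x f. x \<in> carrier X \<Longrightarrow> nrm X x = 1 \<Longrightarrow> f \<in> dual X \<Longrightarrow> dual_norm X f = 1 \<Longrightarrow> f x = 1 \<Longrightarrow>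
    norm (f (T x)) \<le> C"
  shows "numerical_radius X T \<le> C"
  unfolding numerical_radius_def
proof (rule cSup_least)
  obtain x where x: "x \<in> carrier X" "nrm X x = 1" by (rule exists_unit_vector)
  then obtain f where "f \<in> dual X" "dual_norm X f = 1" "f x = 1"
    by (rule exists_normalised_support_functional)
  with x show "{norm (f (T x)) |x f. x \<in> carrier X \<and> nrm X x = 1 \<and> f \<in> dual X \<and>
      dual_norm X f = 1 \<and> f x = 1} \<noteq> {}"
    by auto
qed (use assms in auto)

lemma op_norm_id: "op_norm X X (\<lambda>x. x) = 1"
proof (rule antisym)
  show "op_norm X X (\<lambda>x. x) \<le> 1"
    using seminormed_pair.op_norm_le[OF pair bounded_by_id[of X]] by blast
  obtain x where "x \<in> carrier X" "nrm X x = 1" by (rule exists_unit_vector)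
  then show "1 \<le> op_norm X X (\<lambda>x. x)"
    using seminormed_pair.le_op_norm_if_unit[OF pair, of "\<lambda>x. x" x]
      bounded_by_imp_bounded_ops[OF bounded_by_id[of X]] by simp
qed

lemma numerical_index_le:
  assumes "T \<in> bounded_ops X X" "op_norm X X T = 1"
  shows "numerical_index X \<le> numerical_radius X T"
  unfolding numerical_index_def
  using assms numerical_radius_nonneg by (intro cInf_lower bdd_belowI[of _ 0]) auto

lemma le_numerical_index:
  assumes "\<And>T. T \<in> bounded_ops X X \<Longrightarrow> op_norm X X T = 1 \<Longrightarrow> C \<le> numerical_radius X T"
  shows "C \<le> numerical_index X"
  unfolding numerical_index_def
proof (rule cInf_greatest)
  show "{numerical_radius X T |T. T \<in> bounded_ops X X \<and> op_norm X X T = 1} \<noteq> {}"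
    using op_norm_id bounded_by_imp_bounded_ops[OF bounded_by_id[of X]] by auto
qed (use assms in auto)

text \<open>
  A support functional \<open>f\<close> of a unit vector \<open>x\<close> gives
  \<open>\<bar>f (x - c T x)\<bar> \<ge> 1 - \<bar>c\<bar> \<bar>f (T x)\<bar>\<close>.
\<close>

lemma nrm_le_nrm_diff:
  assumes T: "T \<in> bounded_ops X X" and x: "x \<in> carrier X"
  shows "(1 - norm c * numerical_radius X T) * nrm X x \<le> nrm X (x \<ominus> c \<odot> T x)"
proof -
  note L = linear_mapsD[OF bounded_ops_imp_linear_maps[OF T]]
  have unit: "1 - norm c * numerical_radius X T \<le> nrm X (x \<ominus> c \<odot> T x)"
    if x: "x \<in> carrier X" "nrm X x = 1" for x
  proof -
    obtain f where f: "f \<in> dual X" "dual_norm X f = 1" "f x = 1"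
      using x by (rule exists_normalised_support_functional)
    note F = bounded_byD[OF dual_bounded_by[OF f(1)]]
    note FL = linear_mapsD[OF F(1)]
    have "f (x \<ominus> c \<odot> T x) = 1 - c * f (T x)"
      using FL(2)[of x "(- c) \<odot> T x"] FL(3)[of "T x" "- c"] L(1) x f
      by (simp add: a_minus_def)
    then have "norm (1 - c * f (T x)) \<le> nrm X (x \<ominus> c \<odot> T x)"
      using F(3)[of "x \<ominus> c \<odot> T x"] f(2) x L(1) by simp
    moreover have "1 - norm c * norm (f (T x)) \<le> norm (1 - c * f (T x))"
      using norm_triangle_ineq2[of 1 "c * f (T x)"] by (simp add: norm_mult)
    moreover have "norm c * norm (f (T x)) \<le> norm c * numerical_radius X T"
      using norm_le_numerical_radius[OF T x f] by (rule mult_left_mono) simp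
    ultimately show ?thesis by linarith
  qed
  show ?thesis
  proof (cases "nrm X x = 0")
    case True
    then show ?thesis using x L(1) by simp
  next
    case False
    then have pos: "0 < nrm X x" using nrm_nonneg[OF x] by simp
    define e where "e = of_real (1 / nrm X x) \<odot> x"
    have e: "e \<in> carrier X" "nrm X e = 1"
      using x pos by (simp_all add: e_def nrm_smult norm_divide)
    have "e \<ominus> c \<odot> T e = of_real (1 / nrm X x) \<odot> (x \<ominus> c \<odot> T x)"
      using x L by (simp add: e_def smult_diff_right mult.commute)
    then have "nrm X (x \<ominus> c \<odot> T x) = nrm X x * nrm X (e \<ominus> c \<odot> T e)"
      using x L pos by (simp add: nrm_smult norm_divide)
    then show ?thesis using unit[OF e] pos by (simp add: mult.commute)
  qed
qed

text \<open>
  Applying the previous estimate to \<open>y + c T y\<close> leaves \<open>y - c\<^sup>2 T\<^sup>2 y\<close> on the right, and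
  so bounds the norm of the identity plus \<open>c T\<close> by \<open>1 + \<bar>c\<bar> v(T)\<close>, up to terms
  quadratic in \<open>c\<close>.
\<close>

lemma bounded_by_id_add_numerical_radius:
  assumes T: "T \<in> bounded_ops X X" and c: "norm c * numerical_radius X T < 1"
  shows "bounded_by X X (\<lambda>x. x \<oplus> c \<odot> T x)
    ((1 + (norm c)\<^sup>2 * (op_norm X X T)\<^sup>2) / (1 - norm c * numerical_radius X T))"
proof (rule bounded_byI)
  have B: "bounded_by X X T (op_norm X X T)"
    using T by (rule seminormed_pair.bounded_by_op_norm[OF pair])
  note L = linear_mapsD[OF bounded_byD(1)[OF B]]
  show "(\<lambda>x. x \<oplus> c \<odot> T x) \<in> linear_maps X X"
    using bounded_by_id_add[OF B] by (rule bounded_byD)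
  show "0 \<le> (1 + (norm c)\<^sup>2 * (op_norm X X T)\<^sup>2) / (1 - norm c * numerical_radius X T)"
    using c by simp
  fix y assume y: "y \<in> carrier X"
  have "(y \<oplus> c \<odot> T y) \<ominus> c \<odot> T (y \<oplus> c \<odot> T y) = y \<ominus> (c * c) \<odot> T (T y)"
  proof -
    have "c \<odot> T (y \<oplus> c \<odot> T y) = c \<odot> T y \<oplus> (c * c) \<odot> T (T y)"
      using y L by (simp add: smult_add_right)
    then show ?thesis
      using y L by (simp add: a_minus_def V.minus_add V.a_assoc V.r_neg1 V.r_neg2)
  qed
  then have "(1 - norm c * numerical_radius X T) * nrm X (y \<oplus> c \<odot> T y) \<le>
      nrm X (y \<ominus> (c * c) \<odot> T (T y))"
    using nrm_le_nrm_diff[OF T, of "y \<oplus> c \<odot> T y" c] y L by simp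
  also have "\<dots> \<le> nrm X y + (norm c)\<^sup>2 * nrm X (T (T y))"
    using nrm_diff_le[of y "(c * c) \<odot> T (T y)"] y L
    by (simp add: nrm_smult norm_mult power2_eq_square)
  also have "\<dots> \<le> nrm X y + (norm c)\<^sup>2 * ((op_norm X X T)\<^sup>2 * nrm X y)"
    using bounded_byD(3)[OF bounded_by_comp[OF B B] y]
    by (intro add_left_mono mult_left_mono) (simp_all add: power2_eq_square)
  also have "\<dots> = (1 + (norm c)\<^sup>2 * (op_norm X X T)\<^sup>2) * nrm X y"
    by (simp add: algebra_simps)
  finally have "(1 - norm c * numerical_radius X T) * nrm X (y \<oplus> c \<odot> T y) \<le>
      (1 + (norm c)\<^sup>2 * (op_norm X X T)\<^sup>2) * nrm X y" .
  then show "nrm X (y \<oplus> c \<odot> T y) \<le>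
      (1 + (norm c)\<^sup>2 * (op_norm X X T)\<^sup>2) / (1 - norm c * numerical_radius X T) * nrm X y"
    using c by (simp add: pos_le_divide_eq mult.commute)
qed

end

text \<open>
  If \<open>f\<close> supports the unit vector \<open>z\<close>, then \<open>f (z + c S z) = 1 + c f (S z)\<close>, so the growth rate of
  \<open>\<parallel>I + c S\<parallel>\<close> at \<open>c = 0\<close> bounds \<open>\<bar>f (S z)\<bar>\<close>. It is at most the growth rate of
  \<open>\<parallel>I + c T\<parallel>\<close>, which the previous estimate bounds by the numerical radius of \<open>T\<close>.
\<close>

theorem numerical_radius_transfer:
  assumes "nontrivial_normed_space X" "nontrivial_normed_space Z"
    and T: "T \<in> bounded_ops X X" and S: "S \<in> linear_maps Z Z"
    and le: "\<And>c C. bounded_by X X (\<lambda>x. x \<oplus>\<^bsub>X\<^esub> c \<odot>\<^bsub>X\<^esub> T x) C \<Longrightarrow>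
      bounded_by Z Z (\<lambda>z. z \<oplus>\<^bsub>Z\<^esub> c \<odot>\<^bsub>Z\<^esub> S z) C"
  shows "numerical_radius Z S \<le> numerical_radius X T"
proof -
  interpret X: nontrivial_normed_space X by fact
  interpret Z: nontrivial_normed_space Z by fact
  let ?v = "numerical_radius X T" and ?M = "(op_norm X X T)\<^sup>2"
  have v: "0 \<le> ?v" using T by (rule X.numerical_radius_nonneg)
  show ?thesis
  proof (rule Z.numerical_radius_le)
    fix z f assume z: "z \<in> carrier Z" "nrm Z z = 1"
      and f: "f \<in> dual Z" "dual_norm Z f = 1" "f z = 1"
    note F = bounded_byD[OF Z.dual_bounded_by[OF f(1)]]
    note FL = linear_mapsD[OF F(1)]
    let ?w = "norm (f (S z))"
    \<comment> \<open>The direction of \<open>c\<close> is chosen such that \<open>c * f (S z)\<close> is a nonnegative real number.\<close>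
    obtain u where u: "norm u = 1" "u * f (S z) = of_real ?w" by (rule exists_phase)
    have *: "?w - ?v \<le> t * (?M + ?w * ?v)" if t: "0 < t" "t * ?v < 1" for t
    proof -
      let ?c = "of_real t * u"
      have c: "norm ?c = t" using u t by (simp add: norm_mult)
      have Sz: "S z \<in> carrier Z" using S z by (auto intro: linear_mapsD)
      have "f (z \<oplus>\<^bsub>Z\<^esub> ?c \<odot>\<^bsub>Z\<^esub> S z) = 1 + of_real t * of_real ?w"
        using z Sz f FL u by (simp add: mult.assoc)
      then have "f (z \<oplus>\<^bsub>Z\<^esub> ?c \<odot>\<^bsub>Z\<^esub> S z) = of_real (1 + t * ?w)" by simp
      then have "1 + t * ?w = norm (f (z \<oplus>\<^bsub>Z\<^esub> ?c \<odot>\<^bsub>Z\<^esub> S z))"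
        using t by (simp only: norm_of_real) simp
      also have "\<dots> \<le> nrm Z (z \<oplus>\<^bsub>Z\<^esub> ?c \<odot>\<^bsub>Z\<^esub> S z)"
        using F(3)[of "z \<oplus>\<^bsub>Z\<^esub> ?c \<odot>\<^bsub>Z\<^esub> S z"] f z Sz by simp
      also have "\<dots> \<le> (1 + t\<^sup>2 * ?M) / (1 - t * ?v)"
        using bounded_byD(3)[OF le[OF X.bounded_by_id_add_numerical_radius[OF T, of ?c]] z(1)] c t z(2)
        by simp
      finally have "(1 + t * ?w) * (1 - t * ?v) \<le> 1 + t\<^sup>2 * ?M"
        using t by (simp add: pos_le_divide_eq)
      then have "t * (?w - ?v) \<le> t * (t * (?M + ?w * ?v))"
        by (simp add: algebra_simps power2_eq_square)
      then show ?thesis using t by simp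
    qed
    have "((\<lambda>t. t * (?M + ?w * ?v)) \<longlongrightarrow> 0 * (?M + ?w * ?v)) (at_right 0)"
      by (intro tendsto_intros)
    moreover have "\<forall>\<^sub>F t in at_right 0. ?w - ?v \<le> t * (?M + ?w * ?v)"
    proof -
      have "\<forall>\<^sub>F t in at_right 0. t < 1 / (?v + 1)"
        using v by (intro eventually_at_right_less order_tendstoD(2)[OF tendsto_ident_at]) simp
      then show ?thesis
        using eventually_at_right_less[of "0::real"]
      proof eventually_elim
        case (elim t)
        then have "t * (?v + 1) < 1" using v by (simp add: pos_less_divide_eq)
        then have "t * ?v < 1" using elim by (simp add: algebra_simps)
        then show ?case using elim by (intro *)
      qed
    qed
    ultimately have "?w - ?v \<le> 0"
      using tendsto_lowerbound[OF _ _ trivial_limit_at_right_real] by fastforce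
    then show "?w \<le> ?v" by simp
  qed
qed

text \<open>
  It suffices to send operators on \<open>X\<close> isometrically to operators on \<open>Z\<close> in such a way that
  \<open>\<parallel>I + c T\<parallel>\<close> does not increase.
\<close>

corollary numerical_index_transfer:
  assumes X: "nontrivial_normed_space X" and Z: "nontrivial_normed_space Z"
    and \<Phi>: "\<And>T. T \<in> bounded_ops X X \<Longrightarrow> \<Phi> T \<in> bounded_ops Z Z"
    and \<Phi>_norm: "\<And>T. T \<in> bounded_ops X X \<Longrightarrow> op_norm Z Z (\<Phi> T) = op_norm X X T"
    and \<Phi>_id_add: "\<And>T c C. T \<in> bounded_ops X X \<Longrightarrow>
      bounded_by X X (\<lambda>x. x \<oplus>\<^bsub>X\<^esub> c \<odot>\<^bsub>X\<^esub> T x) C \<Longrightarrow>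
      bounded_by Z Z (\<lambda>z. z \<oplus>\<^bsub>Z\<^esub> c \<odot>\<^bsub>Z\<^esub> \<Phi> T z) C"
  shows "numerical_index Z \<le> numerical_index X"
proof (rule nontrivial_normed_space.le_numerical_index[OF X])
  fix T assume T: "T \<in> bounded_ops X X" "op_norm X X T = 1"
  have "numerical_index Z \<le> numerical_radius Z (\<Phi> T)"
    using T by (intro nontrivial_normed_space.numerical_index_le[OF Z]) (simp_all add: \<Phi> \<Phi>_norm)
  also have "\<dots> \<le> numerical_radius X T"
    using T by (intro numerical_radius_transfer[OF X Z] bounded_ops_imp_linear_maps \<Phi> \<Phi>_id_add)
  finally show "numerical_index Z \<le> numerical_radius X T" .
qed

section \<open>Completions\<close>

definition seq_class :: "('k, 'v) normed \<Rightarrow> (nat \<Rightarrow> 'v) \<Rightarrow> (nat \<Rightarrow> 'v) set" where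
  "seq_class X s = null_rel X `` {s}"

definition completion_map ::
    "('k, 'w) normed \<Rightarrow> ('v \<Rightarrow> 'w) \<Rightarrow> (nat \<Rightarrow> 'v) set \<Rightarrow> (nat \<Rightarrow> 'w) set" where
  "completion_map Y T P = (\<Union>s\<in>P. seq_class Y (\<lambda>n. T (s n)))"

lemma cauchy_seq_carrier: "cauchy_seq X s \<Longrightarrow> s n \<in> carrier X"
  by (auto simp: cauchy_seq_def)

lemma null_rel_iff:
  "(s, t) \<in> null_rel X \<longleftrightarrow>
    cauchy_seq X s \<and> cauchy_seq X t \<and> (\<lambda>n. nrm X (s n \<ominus>\<^bsub>X\<^esub> t n)) \<longlonglongrightarrow> 0"
  by (simp add: null_rel_def)

lemma completion_simps:
  "carrier (completion X) = Collect (cauchy_seq X) // null_rel X"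
  "\<zero>\<^bsub>completion X\<^esub> = seq_class X (\<lambda>n. \<zero>\<^bsub>X\<^esub>)"
  "P \<oplus>\<^bsub>completion X\<^esub> Q = (\<Union>s\<in>P. \<Union>t\<in>Q. seq_class X (\<lambda>n. s n \<oplus>\<^bsub>X\<^esub> t n))"
  "c \<odot>\<^bsub>completion X\<^esub> P = completion_map X (\<lambda>x. c \<odot>\<^bsub>X\<^esub> x) P"
  "nrm (completion X) P = (THE r. \<forall>s\<in>P. (\<lambda>n. nrm X (s n)) \<longlonglongrightarrow> r)"
  by (simp_all add: completion_def seq_class_def completion_map_def)

lemma cauchy_seqD:
  assumes "cauchy_seq X s" "0 < e"
  shows "\<exists>N. \<forall>m\<ge>N. \<forall>n\<ge>N. nrm X (s m \<ominus>\<^bsub>X\<^esub> s n) < e"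
  using assms unfolding cauchy_seq_def by simp

lemma cauchy_seqI:
  assumes "\<And>n. s n \<in> carrier X"
    and "\<And>e. 0 < e \<Longrightarrow> \<exists>N. \<forall>m\<ge>N. \<forall>n\<ge>N. nrm X (s m \<ominus>\<^bsub>X\<^esub> s n) < e"
  shows "cauchy_seq X s"
  using assms by (auto simp: cauchy_seq_def)

context seminormed_space
begin

lemma nrm_diff_tendsto_0:
  assumes "\<And>n. u n \<in> carrier X" "\<And>n. nrm X (u n) \<le> b n" "b \<longlonglongrightarrow> 0"
  shows "(\<lambda>n. nrm X (u n)) \<longlonglongrightarrow> 0"
proof (rule tendsto_sandwich[OF _ _ tendsto_const assms(3)])
  show "\<forall>\<^sub>F n in sequentially. 0 \<le> nrm X (u n)"
    using nrm_nonneg[OF assms(1)] by (intro always_eventually allI)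
  show "\<forall>\<^sub>F n in sequentially. nrm X (u n) \<le> b n"
    using assms(2) by (intro always_eventually allI)
qed

lemma cauchy_seq_const: "x \<in> carrier X \<Longrightarrow> cauchy_seq X (\<lambda>n. x)"
  by (auto simp: cauchy_seq_def)

lemma cauchy_seq_add:
  assumes s: "cauchy_seq X s" and t: "cauchy_seq X t"
  shows "cauchy_seq X (\<lambda>n. s n \<oplus> t n)"
proof (rule cauchy_seqI)
  note C = cauchy_seq_carrier[OF s] cauchy_seq_carrier[OF t]
  show "s n \<oplus> t n \<in> carrier X" for n using C by simp
  fix e :: real assume "0 < e"
  then have e: "0 < e / 2" by simp
  obtain M where M: "\<forall>m\<ge>M. \<forall>n\<ge>M. nrm X (s m \<ominus> s n) < e / 2"
    using cauchy_seqD[OF s e] by blast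
  obtain N where N: "\<forall>m\<ge>N. \<forall>n\<ge>N. nrm X (t m \<ominus> t n) < e / 2"
    using cauchy_seqD[OF t e] by blast
  have "nrm X ((s m \<oplus> t m) \<ominus> (s n \<oplus> t n)) < e" if "m \<ge> max M N" "n \<ge> max M N" for m n
  proof -
    have "nrm X ((s m \<oplus> t m) \<ominus> (s n \<oplus> t n)) \<le> nrm X (s m \<ominus> s n) + nrm X (t m \<ominus> t n)"
      using nrm_add_le[of "s m \<ominus> s n" "t m \<ominus> t n"] C by (simp add: add_diff_add)
    with M[rule_format, of m n] N[rule_format, of m n] that show ?thesis by simp
  qed
  then show "\<exists>N. \<forall>m\<ge>N. \<forall>n\<ge>N. nrm X ((s m \<oplus> t m) \<ominus> (s n \<oplus> t n)) < e"
    by (intro exI[of _ "max M N"] allI impI)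
qed

lemma equiv_null_rel: "equiv (Collect (cauchy_seq X)) (null_rel X)"
proof (rule equivI)
  show "null_rel X \<subseteq> Collect (cauchy_seq X) \<times> Collect (cauchy_seq X)"
    by (auto simp: null_rel_iff)
  show "refl_on (Collect (cauchy_seq X)) (null_rel X)"
    by (auto simp: refl_on_def null_rel_iff cauchy_seq_carrier)
  show "sym (null_rel X)"
    by (auto simp: sym_def null_rel_iff nrm_diff_commute cauchy_seq_carrier)
  show "trans (null_rel X)"
  proof (rule transI)
    fix s t u assume st: "(s, t) \<in> null_rel X" and tu: "(t, u) \<in> null_rel X"
    then have C: "s n \<in> carrier X" "t n \<in> carrier X" "u n \<in> carrier X" for n
      by (auto simp: null_rel_iff cauchy_seq_carrier)
    have "(\<lambda>n. nrm X (s n \<ominus> t n) + nrm X (t n \<ominus> u n)) \<longlonglongrightarrow> 0 + 0"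
      using st tu by (intro tendsto_add) (auto simp: null_rel_iff)
    then have "(\<lambda>n. nrm X (s n \<ominus> u n)) \<longlonglongrightarrow> 0"
      using C nrm_triangle_diff by (intro nrm_diff_tendsto_0) auto
    then show "(s, u) \<in> null_rel X" using st tu by (auto simp: null_rel_iff)
  qed
qed

lemma seq_class_eq_iff:
  "cauchy_seq X s \<Longrightarrow> cauchy_seq X t \<Longrightarrow> seq_class X s = seq_class X t \<longleftrightarrow> (s, t) \<in> null_rel X"
  unfolding seq_class_def using eq_equiv_class_iff[OF equiv_null_rel] by simp

lemma seq_class_eqI: "(s, t) \<in> null_rel X \<Longrightarrow> seq_class X s = seq_class X t"
  using seq_class_eq_iff by (auto simp: null_rel_iff)

lemma seq_class_carrier: "cauchy_seq X s \<Longrightarrow> seq_class X s \<in> carrier (completion X)"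
  by (auto simp: completion_simps seq_class_def intro: quotientI)

lemma carrier_completionE:
  assumes "P \<in> carrier (completion X)"
  obtains s where "cauchy_seq X s" "P = seq_class X s"
  using assms by (auto simp: completion_simps seq_class_def elim: quotientE)

lemma seq_class_self: "cauchy_seq X s \<Longrightarrow> s \<in> seq_class X s"
  using equiv_class_self[OF equiv_null_rel] by (simp add: seq_class_def)

lemma completion_add:
  assumes s: "cauchy_seq X s" and t: "cauchy_seq X t"
  shows "seq_class X s \<oplus>\<^bsub>completion X\<^esub> seq_class X t = seq_class X (\<lambda>n. s n \<oplus> t n)"
proof -
  have "seq_class X (\<lambda>n. s' n \<oplus> t' n) = seq_class X (\<lambda>n. s n \<oplus> t n)"
    if "s' \<in> seq_class X s" "t' \<in> seq_class X t" for s' t'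
  proof -
    have st: "(s, s') \<in> null_rel X" "(t, t') \<in> null_rel X" using that by (auto simp: seq_class_def)
    then have c: "cauchy_seq X s'" "cauchy_seq X t'" by (auto simp: null_rel_iff)
    note C = cauchy_seq_carrier[OF s] cauchy_seq_carrier[OF t]
      cauchy_seq_carrier[OF c(1)] cauchy_seq_carrier[OF c(2)]
    have "(\<lambda>n. nrm X (s n \<ominus> s' n) + nrm X (t n \<ominus> t' n)) \<longlonglongrightarrow> 0 + 0"
      using st by (intro tendsto_add) (auto simp: null_rel_iff)
    then have "(\<lambda>n. nrm X ((s n \<oplus> t n) \<ominus> (s' n \<oplus> t' n))) \<longlonglongrightarrow> 0"
      using C by (intro nrm_diff_tendsto_0) (auto simp: add_diff_add intro: nrm_add_le)
    then show ?thesis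
      using s t c by (intro seq_class_eqI[symmetric]) (simp add: null_rel_iff cauchy_seq_add)
  qed
  then have "seq_class X s \<oplus>\<^bsub>completion X\<^esub> seq_class X t =
      (\<Union>s'\<in>seq_class X s. \<Union>t'\<in>seq_class X t. seq_class X (\<lambda>n. s n \<oplus> t n))"
    unfolding completion_simps by (intro SUP_cong refl)
  also have "\<dots> = seq_class X (\<lambda>n. s n \<oplus> t n)"
    using seq_class_self[OF s] seq_class_self[OF t] by blast
  finally show ?thesis .
qed

lemma nrm_completion:
  assumes s: "cauchy_seq X s"
  shows "(\<lambda>n. nrm X (s n)) \<longlonglongrightarrow> nrm (completion X) (seq_class X s)"
proof -
  have "Cauchy (\<lambda>n. nrm X (s n))"
  proof (rule metric_CauchyI)
    fix e :: real assume e: "0 < e"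
    obtain N where N: "\<forall>m\<ge>N. \<forall>n\<ge>N. nrm X (s m \<ominus> s n) < e"
      using cauchy_seqD[OF s e] by blast
    have "dist (nrm X (s m)) (nrm X (s n)) < e" if "m \<ge> N" "n \<ge> N" for m n
      using nrm_reverse_triangle[of "s m" "s n"] N[rule_format, OF that] cauchy_seq_carrier[OF s]
      by (simp add: dist_real_def)
    then show "\<exists>M. \<forall>m\<ge>M. \<forall>n\<ge>M. dist (nrm X (s m)) (nrm X (s n)) < e"
      by (intro exI[of _ N] allI impI)
  qed
  then obtain L where L: "(\<lambda>n. nrm X (s n)) \<longlonglongrightarrow> L"
    by (auto simp: Cauchy_convergent_iff convergent_def)
  have "nrm (completion X) (seq_class X s) = L"
    unfolding completion_simps
  proof (rule the_equality)
    show "\<forall>t\<in>seq_class X s. (\<lambda>n. nrm X (t n)) \<longlonglongrightarrow> L"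
    proof
      fix t assume "t \<in> seq_class X s"
      then have st: "(s, t) \<in> null_rel X" by (simp add: seq_class_def)
      then have C: "s n \<in> carrier X" "t n \<in> carrier X" for n
        by (auto simp: null_rel_iff cauchy_seq_carrier)
      have "norm (nrm X (t n) - nrm X (s n)) \<le> nrm X (s n \<ominus> t n)" for n
        using nrm_reverse_triangle[of "s n" "t n"] C by (simp add: abs_minus_commute)
      then have "\<forall>\<^sub>F n in sequentially. norm (nrm X (t n) - nrm X (s n)) \<le> norm (nrm X (s n \<ominus> t n)) * 1"
        using C by (intro always_eventually) simp
      moreover have "(\<lambda>n. nrm X (s n \<ominus> t n)) \<longlonglongrightarrow> 0" using st by (simp add: null_rel_iff)
      ultimately have "(\<lambda>n. nrm X (t n) - nrm X (s n)) \<longlonglongrightarrow> 0" by (rule tendsto_0_le[rotated])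
      from tendsto_add[OF this L] show "(\<lambda>n. nrm X (t n)) \<longlonglongrightarrow> L" by simp
    qed
  next
    fix r assume "\<forall>t\<in>seq_class X s. (\<lambda>n. nrm X (t n)) \<longlonglongrightarrow> r"
    then have "(\<lambda>n. nrm X (s n)) \<longlonglongrightarrow> r" using seq_class_self[OF s] by (rule bspec)
    then show "r = L" using L by (rule LIMSEQ_unique)
  qed
  with L show ?thesis by simp
qed

lemma nrm_completion_const:
  "x \<in> carrier X \<Longrightarrow> nrm (completion X) (seq_class X (\<lambda>n. x)) = nrm X x"
  using LIMSEQ_unique[OF nrm_completion[OF cauchy_seq_const, of x] tendsto_const] .

end

context seminormed_pair
begin

lemma linear_map_diff:
  assumes "T \<in> linear_maps X Y" "x \<in> carrier X" "y \<in> carrier X"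
  shows "T (x \<ominus>\<^bsub>X\<^esub> y) = T x \<ominus>\<^bsub>Y\<^esub> T y"
proof -
  have "T (x \<oplus>\<^bsub>X\<^esub> (- 1) \<odot>\<^bsub>X\<^esub> y) = T x \<oplus>\<^bsub>Y\<^esub> (- 1) \<odot>\<^bsub>Y\<^esub> T y"
    using assms(2,3) linear_mapsD[OF assms(1)] by (simp del: X.smult_uminus_left Y.smult_uminus_left)
  then show ?thesis using assms linear_mapsD(1)[OF assms(1)] by (simp add: a_minus_def)
qed

lemma cauchy_seq_map:
  assumes T: "bounded_by X Y T C" and s: "cauchy_seq X s"
  shows "cauchy_seq Y (\<lambda>n. T (s n))"
proof (rule cauchy_seqI)
  note c = cauchy_seq_carrier[OF s] and L = bounded_byD(1)[OF T]
  show "T (s n) \<in> carrier Y" for n using c by (rule linear_mapsD(1)[OF L])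
  fix e :: real assume e: "0 < e"
  have C: "0 \<le> C" using T by (rule bounded_byD)
  then have e': "0 < e / (C + 1)" using e by simp
  obtain N where N: "\<forall>m\<ge>N. \<forall>n\<ge>N. nrm X (s m \<ominus>\<^bsub>X\<^esub> s n) < e / (C + 1)"
    using cauchy_seqD[OF s e'] by blast
  have "nrm Y (T (s m) \<ominus>\<^bsub>Y\<^esub> T (s n)) < e" if "m \<ge> N" "n \<ge> N" for m n
  proof -
    have "nrm Y (T (s m) \<ominus>\<^bsub>Y\<^esub> T (s n)) \<le> C * nrm X (s m \<ominus>\<^bsub>X\<^esub> s n)"
      using bounded_byD(3)[OF T, of "s m \<ominus>\<^bsub>X\<^esub> s n"] c by (simp add: linear_map_diff[OF L])
    also have "\<dots> \<le> (C + 1) * nrm X (s m \<ominus>\<^bsub>X\<^esub> s n)"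
      using c by (intro mult_right_mono) auto
    also have "\<dots> < e" using N[rule_format, OF that] C by (simp add: pos_less_divide_eq mult.commute)
    finally show ?thesis .
  qed
  then show "\<exists>N. \<forall>m\<ge>N. \<forall>n\<ge>N. nrm Y (T (s m) \<ominus>\<^bsub>Y\<^esub> T (s n)) < e"
    by (intro exI[of _ N] allI impI)
qed

lemma completion_map_seq_class:
  assumes T: "bounded_by X Y T C" and s: "cauchy_seq X s"
  shows "completion_map Y T (seq_class X s) = seq_class Y (\<lambda>n. T (s n))"
proof -
  note L = bounded_byD(1)[OF T]
  have "seq_class Y (\<lambda>n. T (t n)) = seq_class Y (\<lambda>n. T (s n))" if "t \<in> seq_class X s" for t
  proof -
    have st: "(s, t) \<in> null_rel X" using that by (simp add: seq_class_def)
    then have t: "cauchy_seq X t" by (simp add: null_rel_iff)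
    note c = cauchy_seq_carrier[OF s] cauchy_seq_carrier[OF t]
    have "(\<lambda>n. C * nrm X (s n \<ominus>\<^bsub>X\<^esub> t n)) \<longlonglongrightarrow> C * 0"
      using st by (intro tendsto_mult tendsto_const) (simp add: null_rel_iff)
    moreover have "nrm Y (T (s n) \<ominus>\<^bsub>Y\<^esub> T (t n)) \<le> C * nrm X (s n \<ominus>\<^bsub>X\<^esub> t n)" for n
      using bounded_byD(3)[OF T, of "s n \<ominus>\<^bsub>X\<^esub> t n"] c by (simp add: linear_map_diff[OF L])
    ultimately have "(\<lambda>n. nrm Y (T (s n) \<ominus>\<^bsub>Y\<^esub> T (t n))) \<longlonglongrightarrow> 0"
      using c linear_mapsD(1)[OF L] by (intro Y.nrm_diff_tendsto_0) auto
    then show ?thesis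
      using cauchy_seq_map[OF T s] cauchy_seq_map[OF T t]
      by (intro Y.seq_class_eqI[symmetric]) (simp add: null_rel_iff)
  qed
  then have "completion_map Y T (seq_class X s) =
      (\<Union>t\<in>seq_class X s. seq_class Y (\<lambda>n. T (s n)))"
    unfolding completion_map_def by (intro SUP_cong refl)
  also have "\<dots> = seq_class Y (\<lambda>n. T (s n))" using X.seq_class_self[OF s] by blast
  finally show ?thesis .
qed

end

context seminormed_space
begin

lemma bounded_by_smult: "bounded_by X X (\<lambda>x. c \<odot> x) (norm c)"
  by (intro bounded_byI linear_mapsI) (auto simp: smult_add_right nrm_smult mult.commute)

lemma cauchy_seq_smult: "cauchy_seq X s \<Longrightarrow> cauchy_seq X (\<lambda>n. c \<odot> s n)"
  using seminormed_pair.cauchy_seq_map[OF pair bounded_by_smult] .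

lemma completion_smult:
  "cauchy_seq X s \<Longrightarrow> c \<odot>\<^bsub>completion X\<^esub> seq_class X s = seq_class X (\<lambda>n. c \<odot> s n)"
  by (simp add: completion_simps seminormed_pair.completion_map_seq_class[OF pair bounded_by_smult])

theorem normed_completion: "normed_space (completion X)"
proof -
  note intros = seq_class_carrier cauchy_seq_add cauchy_seq_smult cauchy_seq_const V.M.zero_closed
  note ops = completion_add completion_smult completion_simps(2) intros cauchy_seq_carrier
  have "seminormed_space (completion X)"
  proof (rule seminormed_spaceI, goal_cases)
    case (1 P Q) then show ?case by (auto simp: ops elim!: carrier_completionE)
  next
    case 2 show ?case by (simp add: ops)
  next
    case (3 c P) then show ?case by (auto simp: ops elim!: carrier_completionE)
  next
    case (4 P Q R) then show ?case by (auto simp: ops V.a_assoc elim!: carrier_completionE)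
  next
    case (5 P Q) then show ?case by (auto simp: ops V.a_comm elim!: carrier_completionE)
  next
    case (6 P) then show ?case by (auto simp: ops elim!: carrier_completionE)
  next
    case (7 P) then show ?case by (auto simp: ops elim!: carrier_completionE)
  next
    case (8 a b P) then show ?case by (auto simp: ops smult_add_left elim!: carrier_completionE)
  next
    case (9 a P Q) then show ?case by (auto simp: ops smult_add_right elim!: carrier_completionE)
  next
    case (10 a b P) then show ?case by (auto simp: ops elim!: carrier_completionE)
  next
    case (11 P) then show ?case by (auto simp: ops elim!: carrier_completionE)
  next
    case (12 P Q)
    then obtain s t where st: "cauchy_seq X s" "cauchy_seq X t"
      and PQ: "P = seq_class X s" "Q = seq_class X t" by (auto elim!: carrier_completionE)
    have "(\<lambda>n. nrm X (s n) + nrm X (t n)) \<longlonglongrightarrow> nrm (completion X) P + nrm (completion X) Q"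
      unfolding PQ using st by (intro tendsto_add nrm_completion)
    moreover have "(\<lambda>n. nrm X (s n \<oplus> t n)) \<longlonglongrightarrow> nrm (completion X) (P \<oplus>\<^bsub>completion X\<^esub> Q)"
      unfolding PQ completion_add[OF st] using st by (intro nrm_completion cauchy_seq_add)
    ultimately show ?case
      using st by (intro LIMSEQ_le) (auto intro: nrm_add_le cauchy_seq_carrier)
  next
    case (13 c P)
    then obtain s where s: "cauchy_seq X s" and P: "P = seq_class X s" by (auto elim!: carrier_completionE)
    have "(\<lambda>n. norm c * nrm X (s n)) \<longlonglongrightarrow> norm c * nrm (completion X) P"
      unfolding P using s by (intro tendsto_mult tendsto_const nrm_completion)
    moreover have "(\<lambda>n. nrm X (c \<odot> s n)) \<longlonglongrightarrow> nrm (completion X) (c \<odot>\<^bsub>completion X\<^esub> P)"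
      unfolding P completion_smult[OF s] using s by (intro nrm_completion cauchy_seq_smult)
    ultimately show ?case
      using cauchy_seq_carrier[OF s] by (simp add: nrm_smult LIMSEQ_unique)
  qed
  then show ?thesis
  proof (rule normed_spaceI)
    fix P assume "P \<in> carrier (completion X)" and 0: "nrm (completion X) P = 0"
    then obtain s where s: "cauchy_seq X s" and P: "P = seq_class X s" by (auto elim!: carrier_completionE)
    have "(\<lambda>n. nrm X (s n)) \<longlonglongrightarrow> 0" using nrm_completion[OF s] 0 P by simp
    then have "(s, \<lambda>n. \<zero>) \<in> null_rel X"
      using s cauchy_seq_carrier[OF s] by (simp add: null_rel_iff cauchy_seq_const)
    then show "P = \<zero>\<^bsub>completion X\<^esub>"
      unfolding P completion_simps by (rule seq_class_eqI)
  qed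
qed

end

lemma (in seminormed_pair) bounded_by_completion_map:
  assumes T: "bounded_by X Y T C"
  shows "bounded_by (completion X) (completion Y) (completion_map Y T) C"
proof (rule bounded_byI)
  note L = linear_mapsD[OF bounded_byD(1)[OF T]]
  note ops = completion_map_seq_class[OF T] cauchy_seq_map[OF T] cauchy_seq_carrier
    X.cauchy_seq_add X.completion_add X.cauchy_seq_smult X.completion_smult
    Y.completion_add Y.completion_smult Y.seq_class_carrier
  show "completion_map Y T \<in> linear_maps (completion X) (completion Y)"
    by (rule linear_mapsI) (auto simp: ops L elim!: X.carrier_completionE)
  show "0 \<le> C" using T by (rule bounded_byD)
  fix P assume "P \<in> carrier (completion X)"
  then obtain s where s: "cauchy_seq X s" and P: "P = seq_class X s" by (auto elim!: X.carrier_completionE)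
  have "(\<lambda>n. C * nrm X (s n)) \<longlonglongrightarrow> C * nrm (completion X) P"
    unfolding P using s by (intro tendsto_mult tendsto_const X.nrm_completion)
  moreover have "(\<lambda>n. nrm Y (T (s n))) \<longlonglongrightarrow> nrm (completion Y) (completion_map Y T P)"
    unfolding P completion_map_seq_class[OF T s]
    by (intro Y.nrm_completion cauchy_seq_map[OF T s])
  ultimately show "nrm (completion Y) (completion_map Y T P) \<le> C * nrm (completion X) P"
    using bounded_byD(3)[OF T] cauchy_seq_carrier[OF s] by (intro LIMSEQ_le) auto
qed

section \<open>The numerical index of a completion\<close>

text \<open>
  The hypotheses abstract the two ways in which a factor sits in a tensor product, so that both
  factors are covered by one argument: \<open>\<phi> T\<close> is \<open>T \<otimes> I\<close> or \<open>I \<otimes> T\<close>, and \<open>j\<close> is the tensor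
  with a fixed unit vector of the other factor. The copy \<open>j\<close> of \<open>W\<close> in \<open>V\<close>, on which \<open>\<phi> T\<close> acts
  as \<open>T\<close>, keeps the norm of \<open>\<phi> T\<close> from dropping.
\<close>

theorem numerical_index_completion_le:
  assumes W: "nontrivial_normed_space W" and V: "seminormed_space V"
    and bounded: "\<And>T C. bounded_by W W T C \<Longrightarrow> bounded_by V V (\<phi> T) C"
    and id_add: "\<And>T c v. T \<in> bounded_ops W W \<Longrightarrow> v \<in> carrier V \<Longrightarrow>
      \<phi> (\<lambda>w. w \<oplus>\<^bsub>W\<^esub> c \<odot>\<^bsub>W\<^esub> T w) v = v \<oplus>\<^bsub>V\<^esub> c \<odot>\<^bsub>V\<^esub> \<phi> T v"
    and j: "\<And>w. w \<in> carrier W \<Longrightarrow> j w \<in> carrier V"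
    and nrm_j: "\<And>w. w \<in> carrier W \<Longrightarrow> nrm V (j w) = nrm W w"
    and \<phi>_j: "\<And>T w. T \<in> bounded_ops W W \<Longrightarrow> w \<in> carrier W \<Longrightarrow> \<phi> T (j w) = j (T w)"
  shows "numerical_index (completion V) \<le> numerical_index W"
proof -
  interpret W: nontrivial_normed_space W by fact
  interpret V: seminormed_space V by fact
  interpret Z: normed_space "completion V" by (rule V.normed_completion)
  interpret WW: seminormed_pair W W by (rule W.pair)
  interpret VV: seminormed_pair V V by (rule V.pair)
  interpret ZZ: seminormed_pair "completion V" "completion V" by (rule Z.pair)
  let ?Z = "completion V" and ?\<iota> = "\<lambda>w. seq_class V (\<lambda>n. j w)"
  have \<iota>: "?\<iota> w \<in> carrier ?Z" "nrm ?Z (?\<iota> w) = nrm W w" if "w \<in> carrier W" for w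
    using that by (simp_all add: V.seq_class_carrier V.cauchy_seq_const V.nrm_completion_const j nrm_j)
  have Z: "nontrivial_normed_space ?Z"
  proof unfold_locales
    obtain w where w: "w \<in> carrier W" "nrm W w = 1" by (rule W.exists_unit_vector)
    then have "?\<iota> w \<noteq> \<zero>\<^bsub>?Z\<^esub>" using \<iota>(2)[of w] by auto
    with \<iota>(1)[OF w(1)] show "carrier ?Z \<noteq> {\<zero>\<^bsub>?Z\<^esub>}" by auto
  qed
  define \<Phi> where "\<Phi> T = completion_map V (\<phi> T)" for T
  have \<Phi>_bounded: "bounded_by ?Z ?Z (\<Phi> T) C" if "bounded_by W W T C" for T C
    unfolding \<Phi>_def by (rule VV.bounded_by_completion_map[OF bounded[OF that]])
  have \<Phi>: "\<Phi> T \<in> bounded_ops ?Z ?Z" if "T \<in> bounded_ops W W" for T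
    using \<Phi>_bounded[OF WW.bounded_by_op_norm[OF that]] by (rule bounded_by_imp_bounded_ops)
  show ?thesis
  proof (rule numerical_index_transfer[OF W Z \<Phi>])
    fix T assume T: "T \<in> bounded_ops W W"
    note B = WW.bounded_by_op_norm[OF T]
    have "bounded_by W W T (op_norm ?Z ?Z (\<Phi> T))"
    proof (rule bounded_byI)
      show "T \<in> linear_maps W W" using B by (rule bounded_byD)
      show "0 \<le> op_norm ?Z ?Z (\<Phi> T)" using \<Phi>[OF T] by (rule ZZ.op_norm_nonneg)
      fix w assume w: "w \<in> carrier W"
      then have Tw: "T w \<in> carrier W" using bounded_byD(1)[OF B] by (rule linear_mapsD(1)[rotated])
      have "\<Phi> T (?\<iota> w) = ?\<iota> (T w)"
        using VV.completion_map_seq_class[OF bounded[OF B] V.cauchy_seq_const[OF j[OF w]]] \<phi>_j[OF T w]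
        by (simp add: \<Phi>_def)
      then show "nrm W (T w) \<le> op_norm ?Z ?Z (\<Phi> T) * nrm W w"
        using bounded_byD(3)[OF ZZ.bounded_by_op_norm[OF \<Phi>[OF T]] \<iota>(1)[OF w]] \<iota>(2)[OF w] \<iota>(2)[OF Tw]
        by simp
    qed
    then have "op_norm W W T \<le> op_norm ?Z ?Z (\<Phi> T)" by (rule WW.op_norm_le)
    moreover have "op_norm ?Z ?Z (\<Phi> T) \<le> op_norm W W T" by (rule ZZ.op_norm_le[OF \<Phi>_bounded[OF B]])
    ultimately show "op_norm ?Z ?Z (\<Phi> T) = op_norm W W T" by simp
  next
    fix T c C assume T: "T \<in> bounded_ops W W"
      and C: "bounded_by W W (\<lambda>w. w \<oplus>\<^bsub>W\<^esub> c \<odot>\<^bsub>W\<^esub> T w) C"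
    note B = bounded[OF WW.bounded_by_op_norm[OF T]]
    note C' = \<Phi>_bounded[OF C]
    have eq: "\<Phi> (\<lambda>w. w \<oplus>\<^bsub>W\<^esub> c \<odot>\<^bsub>W\<^esub> T w) P = P \<oplus>\<^bsub>?Z\<^esub> c \<odot>\<^bsub>?Z\<^esub> \<Phi> T P" if "P \<in> carrier ?Z" for P
    proof -
      obtain s where s: "cauchy_seq V s" and P: "P = seq_class V s"
        using \<open>P \<in> carrier ?Z\<close> by (rule V.carrier_completionE)
      note Ts = VV.cauchy_seq_map[OF B s]
      have "\<Phi> (\<lambda>w. w \<oplus>\<^bsub>W\<^esub> c \<odot>\<^bsub>W\<^esub> T w) P = seq_class V (\<lambda>n. s n \<oplus>\<^bsub>V\<^esub> c \<odot>\<^bsub>V\<^esub> \<phi> T (s n))"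
        unfolding \<Phi>_def P VV.completion_map_seq_class[OF bounded[OF C] s]
        using T cauchy_seq_carrier[OF s] by (simp add: id_add)
      also have "\<dots> = P \<oplus>\<^bsub>?Z\<^esub> c \<odot>\<^bsub>?Z\<^esub> \<Phi> T P"
        unfolding \<Phi>_def P VV.completion_map_seq_class[OF B s] V.completion_smult[OF Ts]
        by (rule V.completion_add[OF s V.cauchy_seq_smult[OF Ts], symmetric])
      finally show ?thesis .
    qed
    show "bounded_by ?Z ?Z (\<lambda>P. P \<oplus>\<^bsub>?Z\<^esub> c \<odot>\<^bsub>?Z\<^esub> \<Phi> T P) C"
    proof (rule bounded_byI)
      show "(\<lambda>P. P \<oplus>\<^bsub>?Z\<^esub> c \<odot>\<^bsub>?Z\<^esub> \<Phi> T P) \<in> linear_maps ?Z ?Z"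
        using Z.bounded_by_id_add[OF ZZ.bounded_by_op_norm[OF \<Phi>[OF T]]] by (rule bounded_byD)
      show "0 \<le> C" using C by (rule bounded_byD)
      show "nrm ?Z (P \<oplus>\<^bsub>?Z\<^esub> c \<odot>\<^bsub>?Z\<^esub> \<Phi> T P) \<le> C * nrm ?Z P" if "P \<in> carrier ?Z" for P
        using bounded_byD(3)[OF C' that] by (simp only: eq[OF that])
    qed
  qed
qed

section \<open>Algebraic tensor products\<close>

definition tensors ::
    "('k::real_or_complex, 'a) normed \<Rightarrow> ('k, 'b) normed \<Rightarrow> (('a \<Rightarrow> 'b \<Rightarrow> 'k) \<Rightarrow> 'k) set" where
  "tensors X Y = {u. representations X Y u \<noteq> {}}"

text \<open>
  The operator \<open>T \<otimes> S\<close>. On functionals of bilinear forms it is the adjoint of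
  \<open>B \<mapsto> B \<circ> (T \<times> S)\<close>, so it needs no choice of a representation.
\<close>

definition tensor_map ::
    "('k::real_or_complex, 'a) normed \<Rightarrow> ('k, 'b) normed \<Rightarrow> ('a \<Rightarrow> 'a) \<Rightarrow> ('b \<Rightarrow> 'b) \<Rightarrow>
      (('a \<Rightarrow> 'b \<Rightarrow> 'k) \<Rightarrow> 'k) \<Rightarrow> ('a \<Rightarrow> 'b \<Rightarrow> 'k) \<Rightarrow> 'k" where
  "tensor_map X Y T S u = (\<lambda>B. if B \<in> bilinear_forms X Y then u (\<lambda>x y. B (T x) (S y)) else 0)"

definition product_form :: "('a \<Rightarrow> 'k) \<Rightarrow> ('b \<Rightarrow> 'k) \<Rightarrow> 'a \<Rightarrow> 'b \<Rightarrow> 'k::real_or_complex" where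
  "product_form f g = (\<lambda>x y. f x * g y)"

definition projective_sum :: "('k, 'a) normed \<Rightarrow> ('k, 'b) normed \<Rightarrow> ('a \<times> 'b) list \<Rightarrow> real" where
  "projective_sum X Y ps = (\<Sum>(x, y)\<leftarrow>ps. nrm X x * nrm Y y)"

lemma tensor_space_simps [simp]:
  "carrier (tensor_space X Y N) = tensors X Y"
  "\<zero>\<^bsub>tensor_space X Y N\<^esub> = (\<lambda>B. 0)"
  "u \<oplus>\<^bsub>tensor_space X Y N\<^esub> v = (\<lambda>B. u B + v B)"
  "c \<odot>\<^bsub>tensor_space X Y N\<^esub> u = (\<lambda>B. c * u B)"
  "nrm (tensor_space X Y N) u = N u"
  by (simp_all add: tensor_space_def tensors_def)

lemma representationsI:
  "set ps \<subseteq> carrier X \<times> carrier Y \<Longrightarrow> ps \<in> representations X Y (tensor_sum X Y ps)"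
  by (simp add: representations_def)

lemma representationsD:
  assumes "ps \<in> representations X Y u"
  shows "set ps \<subseteq> carrier X \<times> carrier Y" "u = tensor_sum X Y ps"
  using assms by (simp_all add: representations_def)

lemma tensorsE:
  assumes "u \<in> tensors X Y"
  obtains ps where "set ps \<subseteq> carrier X \<times> carrier Y" "u = tensor_sum X Y ps"
  using assms by (auto simp: tensors_def representations_def)

lemma tensor_sum_tensors: "set ps \<subseteq> carrier X \<times> carrier Y \<Longrightarrow> tensor_sum X Y ps \<in> tensors X Y"
  using representationsI by (fastforce simp: tensors_def)

lemma tensor_sum_Nil: "tensor_sum X Y [] = (\<lambda>B. 0)"
  by (rule ext) (simp add: tensor_sum_def)

lemma tensor_sum_append:
  "tensor_sum X Y (ps @ qs) = (\<lambda>B. tensor_sum X Y ps B + tensor_sum X Y qs B)"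
  by (auto simp: tensor_sum_def)

lemma bilinear_formsD:
  assumes "B \<in> bilinear_forms X Y"
  shows "x \<in> carrier X \<Longrightarrow> B x \<in> linear_maps Y scalar_space"
    and "y \<in> carrier Y \<Longrightarrow> (\<lambda>x. B x y) \<in> linear_maps X scalar_space"
  using assms by (auto simp: bilinear_forms_def)

lemma bilinear_forms_comp:
  assumes "T \<in> linear_maps X X" "S \<in> linear_maps Y Y" "B \<in> bilinear_forms X Y"
  shows "(\<lambda>x y. B (T x) (S y)) \<in> bilinear_forms X Y"
  unfolding bilinear_forms_def
  using linear_maps_comp[OF assms(2) bilinear_formsD(1)[OF assms(3)]]
    linear_maps_comp[OF assms(1) bilinear_formsD(2)[OF assms(3)]]
    linear_mapsD(1)[OF assms(1)] linear_mapsD(1)[OF assms(2)] by simp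

lemma product_form_bilinear:
  assumes "f \<in> linear_maps X scalar_space" "g \<in> linear_maps Y scalar_space"
  shows "product_form f g \<in> bilinear_forms X Y"
  using linear_mapsD[OF assms(1)] linear_mapsD[OF assms(2)]
  by (auto simp: bilinear_forms_def product_form_def algebra_simps intro!: linear_mapsI)

lemma tensor_sum_map:
  assumes "T \<in> linear_maps X X" "S \<in> linear_maps Y Y"
  shows "tensor_sum X Y (map (map_prod T S) ps) = tensor_map X Y T S (tensor_sum X Y ps)"
proof
  fix B
  show "tensor_sum X Y (map (map_prod T S) ps) B = tensor_map X Y T S (tensor_sum X Y ps) B"
    using bilinear_forms_comp[OF assms, of B]
    by (simp add: tensor_sum_def tensor_map_def o_def case_prod_unfold)
qed

lemma map_prod_representations:
  assumes T: "T \<in> linear_maps X X" and S: "S \<in> linear_maps Y Y" and ps: "ps \<in> representations X Y u"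
  shows "map (map_prod T S) ps \<in> representations X Y (tensor_map X Y T S u)"
proof -
  have "set (map (map_prod T S) ps) \<subseteq> carrier X \<times> carrier Y"
    using representationsD(1)[OF ps] linear_mapsD(1)[OF T] linear_mapsD(1)[OF S] by auto
  then show ?thesis
    using tensor_sum_map[OF T S] representationsD(2)[OF ps] representationsI by metis
qed

lemma tensor_map_tensors:
  assumes "T \<in> linear_maps X X" "S \<in> linear_maps Y Y" "u \<in> tensors X Y"
  shows "tensor_map X Y T S u \<in> tensors X Y"
  using assms map_prod_representations[OF assms(1,2)] by (auto simp: tensors_def)

text \<open>
  The relation between the forms is assumed on the carriers only: off the carriers the values of
  bilinear forms are arbitrary.
\<close>

lemma tensor_sum_affine:
  assumes "A \<in> bilinear_forms X Y" "B \<in> bilinear_forms X Y" "D \<in> bilinear_forms X Y"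
    and "set ps \<subseteq> carrier X \<times> carrier Y"
    and "\<And>x y. x \<in> carrier X \<Longrightarrow> y \<in> carrier Y \<Longrightarrow> D x y = a * A x y + b * B x y"
  shows "tensor_sum X Y ps D = a * tensor_sum X Y ps A + b * tensor_sum X Y ps B"
proof -
  have "(\<Sum>(x, y)\<leftarrow>ps. D x y) = a * (\<Sum>(x, y)\<leftarrow>ps. A x y) + b * (\<Sum>(x, y)\<leftarrow>ps. B x y)"
    using assms(4) by (induction ps) (auto simp: assms(5) algebra_simps)
  then show ?thesis using assms(1-3) by (simp add: tensor_sum_def)
qed

lemma norm_tensor_sum_product_form_le:
  assumes f: "bounded_by X scalar_space f C" and g: "bounded_by Y scalar_space g D"
    and ps: "set ps \<subseteq> carrier X \<times> carrier Y"
  shows "norm (tensor_sum X Y ps (product_form f g)) \<le> C * D * projective_sum X Y ps"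
proof -
  have "norm (\<Sum>(x, y)\<leftarrow>ps. f x * g y) \<le> C * D * projective_sum X Y ps"
    using ps
  proof (induction ps)
    case (Cons p ps)
    obtain x y where p: "p = (x, y)" by (cases p)
    have "norm (f x) * norm (g y) \<le> (C * nrm X x) * (D * nrm Y y)"
      using bounded_byD(3)[OF f, of x] bounded_byD(3)[OF g, of y] Cons.prems p
      by (intro mult_mono) (auto intro: order_trans[OF norm_ge_zero])
    then have "norm (f x * g y) \<le> C * D * (nrm X x * nrm Y y)" by (simp add: norm_mult mult_ac)
    moreover have "norm (\<Sum>(x, y)\<leftarrow>ps. f x * g y) \<le> C * D * projective_sum X Y ps"
      using Cons by simp
    ultimately show ?case
      using norm_triangle_ineq[of "f x * g y" "\<Sum>(x, y)\<leftarrow>ps. f x * g y"]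
      by (simp add: p projective_sum_def distrib_left)
  qed (simp add: projective_sum_def)
  then show ?thesis
    using product_form_bilinear[OF bounded_byD(1)[OF f] bounded_byD(1)[OF g]]
    by (simp add: tensor_sum_def product_form_def)
qed

section \<open>Uniform crossnorms\<close>

text \<open>
  The properties shared by the projective and the injective norm. Homogeneity of the seminorm
  is a special case of uniformity, since scalar multiplication is an operator on the first factor.
\<close>

locale uniform_crossnorm = X: seminormed_space X + Y: seminormed_space Y
  for X :: "('k::real_or_complex, 'a) normed" and Y :: "('k, 'b) normed" +
  fixes N :: "(('a \<Rightarrow> 'b \<Rightarrow> 'k) \<Rightarrow> 'k) \<Rightarrow> real"
  assumes nonneg: "u \<in> tensors X Y \<Longrightarrow> 0 \<le> N u"
    and subadditive: "u \<in> tensors X Y \<Longrightarrow> v \<in> tensors X Y \<Longrightarrow> N (\<lambda>B. u B + v B) \<le> N u + N v"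
    and crossnorm: "x \<in> carrier X \<Longrightarrow> y \<in> carrier Y \<Longrightarrow>
      N (tensor_sum X Y [(x, y)]) = nrm X x * nrm Y y"
    and uniform: "bounded_by X X T C \<Longrightarrow> bounded_by Y Y S D \<Longrightarrow> u \<in> tensors X Y \<Longrightarrow>
      N (tensor_map X Y T S u) \<le> C * D * N u"

context seminormed_pair
begin

lemma tensors_add:
  assumes "u \<in> tensors X Y" "v \<in> tensors X Y"
  shows "(\<lambda>B. u B + v B) \<in> tensors X Y"
proof -
  obtain ps where ps: "set ps \<subseteq> carrier X \<times> carrier Y" "u = tensor_sum X Y ps"
    using assms(1) by (rule tensorsE)
  obtain qs where qs: "set qs \<subseteq> carrier X \<times> carrier Y" "v = tensor_sum X Y qs"
    using assms(2) by (rule tensorsE)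
  show ?thesis
    using tensor_sum_tensors[of "ps @ qs" X Y] ps qs by (simp add: tensor_sum_append)
qed

lemma tensor_map_id_add_left:
  assumes T: "T \<in> linear_maps X X" and u: "u \<in> tensors X Y"
  shows "tensor_map X Y (\<lambda>x. x \<oplus>\<^bsub>X\<^esub> c \<odot>\<^bsub>X\<^esub> T x) (\<lambda>y. y) u = (\<lambda>B. u B + c * tensor_map X Y T (\<lambda>y. y) u B)"
proof
  fix B
  obtain ps where ps: "set ps \<subseteq> carrier X \<times> carrier Y" "u = tensor_sum X Y ps"
    using u by (rule tensorsE)
  note L = linear_mapsD[OF T]
  have T': "(\<lambda>x. x \<oplus>\<^bsub>X\<^esub> c \<odot>\<^bsub>X\<^esub> T x) \<in> linear_maps X X"
    by (rule linear_mapsI) (auto simp: L X.smult_add_right X.V.a_ac mult.commute)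
  show "tensor_map X Y (\<lambda>x. x \<oplus>\<^bsub>X\<^esub> c \<odot>\<^bsub>X\<^esub> T x) (\<lambda>y. y) u B = u B + c * tensor_map X Y T (\<lambda>y. y) u B"
  proof (cases "B \<in> bilinear_forms X Y")
    case True
    have "B (x \<oplus>\<^bsub>X\<^esub> c \<odot>\<^bsub>X\<^esub> T x) y = 1 * B x y + c * B (T x) y"
      if "x \<in> carrier X" "y \<in> carrier Y" for x y
      using linear_mapsD(2,3)[OF bilinear_formsD(2)[OF True that(2)]] L(1) that by simp
    from tensor_sum_affine[OF True bilinear_forms_comp[OF T linear_maps_id True] bilinear_forms_comp[OF T' linear_maps_id True]
        ps(1) this]
    show ?thesis using True ps(2) by (simp add: tensor_map_def)
  qed (simp add: ps(2) tensor_map_def tensor_sum_def)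
qed

lemma tensor_map_id_add_right:
  assumes S: "S \<in> linear_maps Y Y" and u: "u \<in> tensors X Y"
  shows "tensor_map X Y (\<lambda>x. x) (\<lambda>y. y \<oplus>\<^bsub>Y\<^esub> c \<odot>\<^bsub>Y\<^esub> S y) u = (\<lambda>B. u B + c * tensor_map X Y (\<lambda>x. x) S u B)"
proof
  fix B
  obtain ps where ps: "set ps \<subseteq> carrier X \<times> carrier Y" "u = tensor_sum X Y ps"
    using u by (rule tensorsE)
  note L = linear_mapsD[OF S]
  have S': "(\<lambda>y. y \<oplus>\<^bsub>Y\<^esub> c \<odot>\<^bsub>Y\<^esub> S y) \<in> linear_maps Y Y"
    by (rule linear_mapsI) (auto simp: L Y.smult_add_right Y.V.a_ac mult.commute)
  show "tensor_map X Y (\<lambda>x. x) (\<lambda>y. y \<oplus>\<^bsub>Y\<^esub> c \<odot>\<^bsub>Y\<^esub> S y) u B = u B + c * tensor_map X Y (\<lambda>x. x) S u B"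
  proof (cases "B \<in> bilinear_forms X Y")
    case True
    have "B x (y \<oplus>\<^bsub>Y\<^esub> c \<odot>\<^bsub>Y\<^esub> S y) = 1 * B x y + c * B x (S y)"
      if "x \<in> carrier X" "y \<in> carrier Y" for x y
      using linear_mapsD(2,3)[OF bilinear_formsD(1)[OF True that(1)]] L(1) that by simp
    from tensor_sum_affine[OF True bilinear_forms_comp[OF linear_maps_id S True] bilinear_forms_comp[OF linear_maps_id S' True]
        ps(1) this]
    show ?thesis using True ps(2) by (simp add: tensor_map_def)
  qed (simp add: ps(2) tensor_map_def tensor_sum_def)
qed

lemma tensor_map_smult:
  assumes u: "u \<in> tensors X Y"
  shows "tensor_map X Y (\<lambda>x. c \<odot>\<^bsub>X\<^esub> x) (\<lambda>y. y) u = (\<lambda>B. c * u B)"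
proof
  fix B
  obtain ps where ps: "set ps \<subseteq> carrier X \<times> carrier Y" "u = tensor_sum X Y ps"
    using u by (rule tensorsE)
  show "tensor_map X Y (\<lambda>x. c \<odot>\<^bsub>X\<^esub> x) (\<lambda>y. y) u B = c * u B"
  proof (cases "B \<in> bilinear_forms X Y")
    case True
    have "B (c \<odot>\<^bsub>X\<^esub> x) y = c * B x y + 0 * B x y" if "x \<in> carrier X" "y \<in> carrier Y" for x y
      using linear_mapsD(3)[OF bilinear_formsD(2)[OF True that(2)]] that by simp
    from tensor_sum_affine[OF True True
        bilinear_forms_comp[OF bounded_byD(1)[OF X.bounded_by_smult] linear_maps_id True] ps(1) this]
    show ?thesis using True ps(2) by (simp add: tensor_map_def)
  qed (simp add: ps(2) tensor_map_def tensor_sum_def)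
qed

end

sublocale uniform_crossnorm \<subseteq> seminormed_pair X Y
  by unfold_locales

context uniform_crossnorm
begin

lemma smult_tensors:
  assumes "u \<in> tensors X Y" shows "(\<lambda>B. c * u B) \<in> tensors X Y"
  using tensor_map_tensors[OF bounded_byD(1)[OF X.bounded_by_smult[of c]]
      bounded_byD(1)[OF bounded_by_id[of Y]] assms]
  by (simp add: tensor_map_smult[OF assms])

lemma homogeneous:
  assumes u: "u \<in> tensors X Y"
  shows "N (\<lambda>B. c * u B) = norm c * N u"
proof (rule antisym)
  have le: "N (\<lambda>B. c * u B) \<le> norm c * N u" if "u \<in> tensors X Y" for c u
    using uniform[OF X.bounded_by_smult[of c] bounded_by_id[of Y] that]
    by (simp add: tensor_map_smult[OF that])
  then show "N (\<lambda>B. c * u B) \<le> norm c * N u" using u .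
  show "norm c * N u \<le> N (\<lambda>B. c * u B)"
  proof (cases "c = 0")
    case True
    then show ?thesis using nonneg[OF smult_tensors[OF u, of c]] by simp
  next
    case False
    have "(\<lambda>B. inverse c * (c * u B)) = u" using False by (simp flip: mult.assoc)
    then have "N u \<le> norm (inverse c) * N (\<lambda>B. c * u B)"
      using le[OF smult_tensors[OF u, of c], of "inverse c"] by simp
    then show ?thesis using False by (simp add: norm_divide field_simps)
  qed
qed

lemma zero_tensors: "(\<lambda>B. 0) \<in> tensors X Y"
  using tensor_sum_tensors[of "[]" X Y] by (simp add: tensor_sum_Nil)

lemma seminormed_tensor_space: "seminormed_space (tensor_space X Y N)"
  by (rule seminormed_spaceI)
    (auto simp: tensors_add zero_tensors smult_tensors subadditive homogeneous algebra_simps)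

lemma bounded_by_tensor_map:
  assumes "bounded_by X X T C" "bounded_by Y Y S D"
  shows "bounded_by (tensor_space X Y N) (tensor_space X Y N) (tensor_map X Y T S) (C * D)"
proof (rule bounded_byI)
  note L = bounded_byD(1)[OF assms(1)] bounded_byD(1)[OF assms(2)]
  show "tensor_map X Y T S \<in> linear_maps (tensor_space X Y N) (tensor_space X Y N)"
    by (rule linear_mapsI) (simp add: tensor_map_tensors[OF L], simp_all add: tensor_map_def fun_eq_iff)
  show "0 \<le> C * D" using bounded_byD(2)[OF assms(1)] bounded_byD(2)[OF assms(2)] by simp
qed (use uniform[OF assms] in simp)

end

text \<open>
  The fixed unit vectors \<open>x0\<close> and \<open>y0\<close> embed each factor isometrically by \<open>y \<mapsto> x0 \<otimes> y\<close> and
  \<open>x \<mapsto> x \<otimes> y0\<close>.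
\<close>

theorem (in uniform_crossnorm) numerical_index_completion_tensor_space_le:
  assumes "nontrivial_normed_space X" "nontrivial_normed_space Y"
  shows "numerical_index (completion (tensor_space X Y N)) \<le> min (numerical_index X) (numerical_index Y)"
proof -
  interpret X': nontrivial_normed_space X by fact
  interpret Y': nontrivial_normed_space Y by fact
  note id = bounded_by_id[of X] bounded_by_id[of Y]
  have elementary: "tensor_sum X Y [(x, y)] \<in> tensors X Y" if "x \<in> carrier X" "y \<in> carrier Y" for x y
    using that by (intro tensor_sum_tensors) simp
  obtain x0 where x0: "x0 \<in> carrier X" "nrm X x0 = 1" by (rule X'.exists_unit_vector)
  obtain y0 where y0: "y0 \<in> carrier Y" "nrm Y y0 = 1" by (rule Y'.exists_unit_vector)
  have "numerical_index (completion (tensor_space X Y N)) \<le> numerical_index X"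
  proof (rule numerical_index_completion_le[OF assms(1) seminormed_tensor_space])
    show "bounded_by (tensor_space X Y N) (tensor_space X Y N) (tensor_map X Y T (\<lambda>y. y)) C"
      if "bounded_by X X T C" for T C
      using bounded_by_tensor_map[OF that id(2)] by simp
    show "tensor_map X Y T (\<lambda>y. y) (tensor_sum X Y [(x, y0)]) = tensor_sum X Y [(T x, y0)]"
      if "T \<in> bounded_ops X X" for T x
      using tensor_sum_map[OF bounded_ops_imp_linear_maps[OF that] bounded_byD(1)[OF id(2)], of "[(x, y0)]"]
      by simp
  qed (use y0 in \<open>simp_all add: tensor_map_id_add_left bounded_ops_imp_linear_maps elementary crossnorm\<close>)
  moreover have "numerical_index (completion (tensor_space X Y N)) \<le> numerical_index Y"
  proof (rule numerical_index_completion_le[OF assms(2) seminormed_tensor_space])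
    show "bounded_by (tensor_space X Y N) (tensor_space X Y N) (tensor_map X Y (\<lambda>x. x) S) C"
      if "bounded_by Y Y S C" for S C
      using bounded_by_tensor_map[OF id(1) that] by simp
    show "tensor_map X Y (\<lambda>x. x) S (tensor_sum X Y [(x0, y)]) = tensor_sum X Y [(x0, S y)]"
      if "S \<in> bounded_ops Y Y" for S y
      using tensor_sum_map[OF bounded_byD(1)[OF id(1)] bounded_ops_imp_linear_maps[OF that], of "[(x0, y)]"]
      by simp
  qed (use x0 in \<open>simp_all add: tensor_map_id_add_right bounded_ops_imp_linear_maps elementary crossnorm\<close>)
  ultimately show ?thesis by simp
qed

section \<open>The projective and the injective norm\<close>

context seminormed_pair
begin

lemma projective_sum_nonneg:
  "set ps \<subseteq> carrier X \<times> carrier Y \<Longrightarrow> 0 \<le> projective_sum X Y ps"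
  by (induction ps) (auto simp: projective_sum_def)

lemma proj_norm_le:
  assumes "ps \<in> representations X Y u"
  shows "proj_norm X Y u \<le> projective_sum X Y ps"
  unfolding proj_norm_def projective_sum_def[symmetric]
  using assms projective_sum_nonneg[OF representationsD(1)]
  by (intro cInf_lower bdd_belowI[of _ 0]) auto

lemma le_proj_norm:
  assumes "u \<in> tensors X Y" "\<And>ps. ps \<in> representations X Y u \<Longrightarrow> a \<le> projective_sum X Y ps"
  shows "a \<le> proj_norm X Y u"
  unfolding proj_norm_def projective_sum_def[symmetric]
  using assms by (intro cInf_greatest) (auto simp: tensors_def)

lemma representations_append:
  assumes "ps \<in> representations X Y u" "qs \<in> representations X Y v"
  shows "ps @ qs \<in> representations X Y (\<lambda>B. u B + v B)"
  using assms by (auto simp: representations_def tensor_sum_append)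

lemma projective_sum_map_le:
  assumes T: "bounded_by X X T C" and S: "bounded_by Y Y S D"
    and ps: "set ps \<subseteq> carrier X \<times> carrier Y"
  shows "projective_sum X Y (map (map_prod T S) ps) \<le> C * D * projective_sum X Y ps"
  using ps
proof (induction ps)
  case (Cons p ps)
  obtain x y where p: "p = (x, y)" by (cases p)
  have "nrm X (T x) * nrm Y (S y) \<le> (C * nrm X x) * (D * nrm Y y)"
    using bounded_byD[OF T] bounded_byD[OF S] Cons.prems p
    by (intro mult_mono) (auto dest: linear_mapsD(1))
  with Cons p show ?case by (simp add: projective_sum_def algebra_simps)
qed (simp add: projective_sum_def)

text \<open>
  For \<open>x\<close> and \<open>y\<close> with support functionals \<open>f\<close> and \<open>g\<close>, evaluation at the form
  \<open>f x * g y\<close> shows that no representation of \<open>x \<otimes> y\<close> is cheaper than the obvious one.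
\<close>

lemma uniform_crossnorm_proj_norm: "uniform_crossnorm X Y (proj_norm X Y)"
proof unfold_locales
  fix u assume "u \<in> tensors X Y"
  then show "0 \<le> proj_norm X Y u"
    using projective_sum_nonneg[OF representationsD(1)] by (rule le_proj_norm)
next
  fix u v assume u: "u \<in> tensors X Y" and v: "v \<in> tensors X Y"
  have *: "proj_norm X Y (\<lambda>B. u B + v B) \<le> projective_sum X Y ps + projective_sum X Y qs"
    if "ps \<in> representations X Y u" "qs \<in> representations X Y v" for ps qs
    using proj_norm_le[OF representations_append[OF that]] by (simp add: projective_sum_def)
  have "proj_norm X Y (\<lambda>B. u B + v B) - proj_norm X Y u \<le> projective_sum X Y qs"
    if "qs \<in> representations X Y v" for qs
  proof -
    have "proj_norm X Y (\<lambda>B. u B + v B) - projective_sum X Y qs \<le> proj_norm X Y u"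
      using *[OF _ that] by (intro le_proj_norm[OF u]) (simp add: algebra_simps)
    then show ?thesis by simp
  qed
  then have "proj_norm X Y (\<lambda>B. u B + v B) - proj_norm X Y u \<le> proj_norm X Y v"
    by (rule le_proj_norm[OF v])
  then show "proj_norm X Y (\<lambda>B. u B + v B) \<le> proj_norm X Y u + proj_norm X Y v" by simp
next
  fix x y assume x: "x \<in> carrier X" and y: "y \<in> carrier Y"
  let ?u = "tensor_sum X Y [(x, y)]"
  have rep: "[(x, y)] \<in> representations X Y ?u" using x y by (intro representationsI) simp
  then have u: "?u \<in> tensors X Y" by (auto simp: tensors_def)
  have "proj_norm X Y ?u \<le> nrm X x * nrm Y y"
    using proj_norm_le[OF rep] by (simp add: projective_sum_def)
  moreover have "nrm X x * nrm Y y \<le> proj_norm X Y ?u"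
  proof (rule le_proj_norm[OF u])
    fix ps assume ps: "ps \<in> representations X Y ?u"
    obtain f where f: "bounded_by X (scalar_space :: ('k, 'k) normed) f 1" "f x = of_real (nrm X x)"
      using x by (rule X.exists_support_functional)
    obtain g where g: "bounded_by Y (scalar_space :: ('k, 'k) normed) g 1" "g y = of_real (nrm Y y)"
      using y by (rule Y.exists_support_functional)
    have "?u (product_form f g) = of_real (nrm X x) * of_real (nrm Y y)"
      using product_form_bilinear[OF bounded_byD(1)[OF f(1)] bounded_byD(1)[OF g(1)]] f(2) g(2)
      by (simp add: tensor_sum_def product_form_def)
    then have "norm (?u (product_form f g)) = nrm X x * nrm Y y"
      using x y by (simp add: norm_mult)
    then show "nrm X x * nrm Y y \<le> projective_sum X Y ps"
      using norm_tensor_sum_product_form_le[OF f(1) g(1) representationsD(1)[OF ps]]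
      by (simp flip: representationsD(2)[OF ps])
  qed
  ultimately show "proj_norm X Y ?u = nrm X x * nrm Y y" by simp
next
  fix T C S D u
  assume T: "bounded_by X X T C" and S: "bounded_by Y Y S D" and u: "u \<in> tensors X Y"
  let ?Tu = "tensor_map X Y T S u"
  have *: "proj_norm X Y ?Tu \<le> C * D * projective_sum X Y ps" if "ps \<in> representations X Y u" for ps
    using proj_norm_le[OF map_prod_representations[OF bounded_byD(1)[OF T] bounded_byD(1)[OF S] that]]
      projective_sum_map_le[OF T S representationsD(1)[OF that]] by simp
  show "proj_norm X Y ?Tu \<le> C * D * proj_norm X Y u"
  proof (cases "C * D = 0")
    case True
    obtain ps where "ps \<in> representations X Y u" using u by (auto simp: tensors_def)
    from *[OF this] show ?thesis by (simp add: True)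
  next
    case False
    then have pos: "0 < C * D" using bounded_byD(2)[OF T] bounded_byD(2)[OF S] by simp
    have "proj_norm X Y ?Tu / (C * D) \<le> proj_norm X Y u"
      using * pos by (intro le_proj_norm[OF u]) (simp add: pos_divide_le_eq mult.commute)
    then show ?thesis using pos by (simp add: pos_divide_le_eq mult.commute)
  qed
qed

text \<open>
  A tensor is a functional on bilinear forms, and \<open>f x * g y\<close> is such a form. Its value at the
  tensor replaces the sum over a representation.
\<close>

lemma inj_norm_eq:
  assumes u: "u \<in> tensors X Y"
  shows "inj_norm X Y u = Sup {norm (u (product_form f g)) | f g.
    bounded_by X scalar_space f 1 \<and> bounded_by Y scalar_space g 1}"
proof -
  have eval: "(\<Sum>(x, y)\<leftarrow>ps. f x * g y) = u (product_form f g)"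
    if "ps \<in> representations X Y u" "bounded_by X scalar_space f 1" "bounded_by Y scalar_space g 1"
    for ps f g
    using representationsD(2)[OF that(1)]
      product_form_bilinear[OF bounded_byD(1)[OF that(2)] bounded_byD(1)[OF that(3)]]
    by (simp add: tensor_sum_def product_form_def)
  obtain ps0 where ps0: "ps0 \<in> representations X Y u" using u by (auto simp: tensors_def)
  have "{norm (\<Sum>(x, y)\<leftarrow>ps. f x * g y) | ps f g. ps \<in> representations X Y u \<and>
       f \<in> dual X \<and> dual_norm X f \<le> 1 \<and> g \<in> dual Y \<and> dual_norm Y g \<le> 1} =
     {norm (\<Sum>(x, y)\<leftarrow>ps. f x * g y) | ps f g. ps \<in> representations X Y u \<and>
       bounded_by X scalar_space f 1 \<and> bounded_by Y scalar_space g 1}"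
    unfolding X.bounded_by_1_iff_dual Y.bounded_by_1_iff_dual by (simp only: conj_assoc)
  also have "\<dots> = {norm (u (product_form f g)) | f g.
      bounded_by X scalar_space f 1 \<and> bounded_by Y scalar_space g 1}" (is "?L = ?R")
  proof
    show "?L \<subseteq> ?R"
    proof
      fix r assume "r \<in> ?L"
      then obtain ps f g where fg: "bounded_by X scalar_space f 1" "bounded_by Y scalar_space g 1"
        and "ps \<in> representations X Y u" "r = norm (\<Sum>(x, y)\<leftarrow>ps. f x * g y)" by blast
      then have "r = norm (u (product_form f g))" using eval by simp
      then show "r \<in> ?R" using fg by blast
    qed
    show "?R \<subseteq> ?L"
    proof
      fix r assume "r \<in> ?R"
      then obtain f g where fg: "bounded_by X scalar_space f 1" "bounded_by Y scalar_space g 1"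
        and "r = norm (u (product_form f g))" by auto
      then have "r = norm (\<Sum>(x, y)\<leftarrow>ps0. f x * g y)" using eval[OF ps0] by simp
      then show "r \<in> ?L" using fg ps0 by blast
    qed
  qed
  finally show ?thesis by (simp add: inj_norm_def)
qed

lemma norm_eval_le_inj_norm:
  assumes u: "u \<in> tensors X Y"
    and "bounded_by X scalar_space f 1" "bounded_by Y scalar_space g 1"
  shows "norm (u (product_form f g)) \<le> inj_norm X Y u"
  unfolding inj_norm_eq[OF u]
proof (rule cSup_upper)
  obtain ps where ps: "set ps \<subseteq> carrier X \<times> carrier Y" "u = tensor_sum X Y ps"
    using u by (rule tensorsE)
  have "norm (u (product_form f g)) \<le> projective_sum X Y ps"
    if "bounded_by X scalar_space f 1" "bounded_by Y scalar_space g 1" for f g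
    using norm_tensor_sum_product_form_le[OF that ps(1)] ps(2) by simp
  then show "bdd_above {norm (u (product_form f g)) | f g.
      bounded_by X scalar_space f 1 \<and> bounded_by Y scalar_space g 1}"
    by (intro bdd_aboveI[of _ "projective_sum X Y ps"]) auto
qed (use assms in auto)

lemma inj_norm_le:
  assumes u: "u \<in> tensors X Y"
    and le: "\<And>f g. bounded_by X scalar_space f 1 \<Longrightarrow> bounded_by Y scalar_space g 1 \<Longrightarrow>
      norm (u (product_form f g)) \<le> a"
  shows "inj_norm X Y u \<le> a"
  unfolding inj_norm_eq[OF u]
proof (rule cSup_least)
  note X.bounded_by_zero Y.bounded_by_zero
  then show "{norm (u (product_form f g)) | f g.
      bounded_by X scalar_space f 1 \<and> bounded_by Y scalar_space g 1} \<noteq> {}"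
    by blast
qed (use le in auto)

text \<open>
  This follows by scaling \<open>f\<close> and \<open>g\<close> into the unit balls, except when \<open>C\<close> or \<open>D\<close> is \<open>0\<close>; then
  one of the functionals vanishes.
\<close>

lemma norm_eval_le_mult_inj_norm:
  assumes u: "u \<in> tensors X Y"
    and f: "bounded_by X scalar_space f C" and g: "bounded_by Y scalar_space g D"
  shows "norm (u (product_form f g)) \<le> C * D * inj_norm X Y u"
proof -
  obtain ps where ps: "set ps \<subseteq> carrier X \<times> carrier Y" "u = tensor_sum X Y ps"
    using u by (rule tensorsE)
  note F = bounded_byD[OF f] and G = bounded_byD[OF g]
  show ?thesis
  proof (cases "C * D = 0")
    case True
    then show ?thesis
      using norm_tensor_sum_product_form_le[OF f g ps(1)] by (simp only: ps(2) True mult_zero_left)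
  next
    case False
    then have pos: "0 < C" "0 < D" using F(2) G(2) by auto
    let ?f = "\<lambda>x. of_real (1 / C) * f x" and ?g = "\<lambda>y. of_real (1 / D) * g y"
    have f': "bounded_by X scalar_space ?f 1"
      using bounded_by_comp[OF f scalar.bounded_by_smult[of "of_real (1 / C)"]] pos
      by (simp add: norm_divide)
    have g': "bounded_by Y scalar_space ?g 1"
      using bounded_by_comp[OF g scalar.bounded_by_smult[of "of_real (1 / D)"]] pos
      by (simp add: norm_divide)
    have bilinear: "product_form f g \<in> bilinear_forms X Y" "product_form ?f ?g \<in> bilinear_forms X Y"
      using f g f' g' by (auto intro: product_form_bilinear dest: bounded_byD(1))
    have "u (product_form f g) = of_real (C * D) * u (product_form ?f ?g) + 0 * u (product_form ?f ?g)"
      unfolding ps(2) using pos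
      by (intro tensor_sum_affine bilinear ps(1)) (simp add: product_form_def)
    then have "norm (u (product_form f g)) = C * D * norm (u (product_form ?f ?g))"
      using pos by (simp add: norm_mult)
    then show ?thesis using norm_eval_le_inj_norm[OF u f' g'] pos by simp
  qed
qed

text \<open>
  Support functionals of \<open>x\<close> and \<open>y\<close> attain the norm of \<open>x \<otimes> y\<close>, and evaluating \<open>(T \<otimes> S) u\<close> at
  \<open>f\<close> and \<open>g\<close> means evaluating \<open>u\<close> at \<open>f \<circ> T\<close> and \<open>g \<circ> S\<close>.
\<close>

lemma uniform_crossnorm_inj_norm: "uniform_crossnorm X Y (inj_norm X Y)"
proof unfold_locales
  fix u assume u: "u \<in> tensors X Y"
  have "norm (u (product_form (\<lambda>_. 0) (\<lambda>_. 0))) \<le> inj_norm X Y u"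
    by (intro norm_eval_le_inj_norm u X.bounded_by_zero Y.bounded_by_zero)
  then show "0 \<le> inj_norm X Y u" by (rule order_trans[OF norm_ge_zero])
next
  fix u v assume u: "u \<in> tensors X Y" and v: "v \<in> tensors X Y"
  show "inj_norm X Y (\<lambda>B. u B + v B) \<le> inj_norm X Y u + inj_norm X Y v"
  proof (rule inj_norm_le[OF tensors_add[OF u v]])
    fix f g assume fg: "bounded_by X scalar_space f 1" "bounded_by Y scalar_space g 1"
    show "norm (u (product_form f g) + v (product_form f g)) \<le> inj_norm X Y u + inj_norm X Y v"
      using norm_triangle_ineq add_mono[OF norm_eval_le_inj_norm[OF u fg] norm_eval_le_inj_norm[OF v fg]]
      by (rule order_trans)
  qed
next
  fix x y assume x: "x \<in> carrier X" and y: "y \<in> carrier Y"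
  let ?u = "tensor_sum X Y [(x, y)]"
  have u: "?u \<in> tensors X Y" using x y by (intro tensor_sum_tensors) simp
  have eval: "norm (?u (product_form f g)) = norm (f x) * norm (g y)"
    if "bounded_by X scalar_space f 1" "bounded_by Y scalar_space g 1" for f g
    using product_form_bilinear[OF bounded_byD(1)[OF that(1)] bounded_byD(1)[OF that(2)]]
    by (simp add: tensor_sum_def product_form_def norm_mult)
  have "inj_norm X Y ?u \<le> nrm X x * nrm Y y"
  proof (rule inj_norm_le[OF u])
    fix f g
    assume f: "bounded_by X (scalar_space :: ('k, 'k) normed) f 1"
      and g: "bounded_by Y (scalar_space :: ('k, 'k) normed) g 1"
    show "norm (?u (product_form f g)) \<le> nrm X x * nrm Y y"
      unfolding eval[OF f g] using bounded_byD(3)[OF f x] bounded_byD(3)[OF g y] x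
      by (intro mult_mono) auto
  qed
  moreover have "nrm X x * nrm Y y \<le> inj_norm X Y ?u"
  proof -
    obtain f where f: "bounded_by X (scalar_space :: ('k, 'k) normed) f 1" "f x = of_real (nrm X x)"
      using x by (rule X.exists_support_functional)
    obtain g where g: "bounded_by Y (scalar_space :: ('k, 'k) normed) g 1" "g y = of_real (nrm Y y)"
      using y by (rule Y.exists_support_functional)
    show ?thesis
      using norm_eval_le_inj_norm[OF u f(1) g(1)] eval[OF f(1) g(1)] f(2) g(2) x y by simp
  qed
  ultimately show "inj_norm X Y ?u = nrm X x * nrm Y y" by simp
next
  fix T C S D u
  assume T: "bounded_by X X T C" and S: "bounded_by Y Y S D" and u: "u \<in> tensors X Y"
  note L = bounded_byD(1)[OF T] bounded_byD(1)[OF S]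
  show "inj_norm X Y (tensor_map X Y T S u) \<le> C * D * inj_norm X Y u"
  proof (rule inj_norm_le[OF tensor_map_tensors[OF L u]])
    fix f g
    assume f: "bounded_by X (scalar_space :: ('k, 'k) normed) f 1"
      and g: "bounded_by Y (scalar_space :: ('k, 'k) normed) g 1"
    have "tensor_map X Y T S u (product_form f g) = u (product_form (\<lambda>x. f (T x)) (\<lambda>y. g (S y)))"
      using product_form_bilinear[OF bounded_byD(1)[OF f] bounded_byD(1)[OF g]]
      by (simp add: tensor_map_def product_form_def)
    then show "norm (tensor_map X Y T S u (product_form f g)) \<le> C * D * inj_norm X Y u"
      using norm_eval_le_mult_inj_norm[OF u bounded_by_comp[OF T f] bounded_by_comp[OF S g]] by simp
  qed
qed

end

section \<open>The numerical index of tensor products\<close>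

theorem theorem3p2:
  fixes X :: "('k::real_or_complex, 'a) normed" and Y :: "('k, 'b) normed"
  assumes "banach_space X" and "carrier X \<noteq> {\<zero>\<^bsub>X\<^esub>}"
    and "banach_space Y" and "carrier Y \<noteq> {\<zero>\<^bsub>Y\<^esub>}"
  shows "numerical_index (X \<otimes>\<^sub>\<pi> Y) \<le> min (numerical_index X) (numerical_index Y) \<and>
         numerical_index (X \<otimes>\<^sub>\<epsilon> Y) \<le> min (numerical_index X) (numerical_index Y)"
proof -
  interpret X: banach_space X by fact
  interpret Y: banach_space Y by fact
  interpret seminormed_pair X Y by unfold_locales
  have X: "nontrivial_normed_space X" using assms by unfold_locales
  have Y: "nontrivial_normed_space Y" using assms by unfold_locales
  show ?thesis
    unfolding projective_tensor_product_def injective_tensor_product_def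
    using uniform_crossnorm.numerical_index_completion_tensor_space_le[OF uniform_crossnorm_proj_norm X Y]
      uniform_crossnorm.numerical_index_completion_tensor_space_le[OF uniform_crossnorm_inj_norm X Y]
    by (rule conjI)
qed

end
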